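(* If a 3-dimensional quasi-para-Sasakian manifold $(M,\varphi,\eta,\xi,g)$ has $\eta$-parallel Ricci tensor, then for all vector fields $X,Y,Z$ $$(\nabla_X\mathrm{Ric})(Y,Z)+(\nabla_Y\mathrm{Ric})(Z,X)+(\nabla_Z\mathrm{Ric})(X,Y)=0.$$
   Context: An almost paracontact metric manifold $(M,\varphi,\eta,\xi,g)$ is a smooth manifold $M$ of dimension $2n+1$ ($n\ge 1$; here $n=1$) with a $(1,1)$-tensor field $\varphi$, a vector field $\xi$, a 1-form $\eta$ and a pseudo-Riemannian metric $g$ such that $\varphi\xi=0$, $\eta\circ\varphi=0$, $\eta(\xi)=1$, $\varphi^2=\mathrm{id}-\eta\otimes\xi$, $\varphi$ induces an almost paracomplex structure on each fibre of $\mathbb D=\ker\eta$, and $g(\varphi X,\varphi Y)=-g(X,Y)+\eta(X)\eta(Y)$ for all $X,Y$ (hence $\eta(X)=g(X,\xi)$ and $g$ has signature $(n+1,n)$). It is quasi-para-Sasakian if $(\nabla_X\varphi)Y=g(X,Y)\xi-\eta(Y)X$ for all vector fields $X,Y$, where $\nabla$ is the Levi-Civita connection of $g$. The curvature tensor is $R(X,Y)Z=\nabla_X\nabla_YZ-\nabla_Y\nabla_XZ-\nabla_{[X,Y]}Z$, and $\mathrm{Ric}(Y,Z)=\mathrm{tr}(X\mapsto R(X,Y)Z)$. The Ricci tensor is called $\eta$-parallel if $(\nabla_X\mathrm{Ric})(\varphi Y,\varphi Z)=0$ for all vector fields $X,Y,Z$. *)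

theory Defs
  imports "HOL-Analysis.Analysis"
begin

section \<open>Smooth functions between Euclidean spaces\<close>

text \<open>\<open>Ck_on k f S\<close> is meant for open \<open>S\<close>: all iterated directional derivatives
  of order at most \<open>k\<close> exist on \<open>S\<close> and are continuous there.\<close>

fun Ck_on :: "nat \<Rightarrow> ('a::real_normed_vector \<Rightarrow> 'b::real_normed_vector) \<Rightarrow> 'a set \<Rightarrow> bool" where
  "Ck_on 0 f S \<longleftrightarrow> continuous_on S f"
| "Ck_on (Suc k) f S \<longleftrightarrow>
     (\<forall>x\<in>S. f differentiable (at x)) \<and> (\<forall>v. Ck_on k (\<lambda>x. frechet_derivative f (at x) v) S)"

definition smooth_on :: "'a set \<Rightarrow> ('a::real_normed_vector \<Rightarrow> 'b::real_normed_vector) \<Rightarrow> bool" where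
  "smooth_on S f \<longleftrightarrow> (\<forall>k. Ck_on k f S)"


section \<open>Smooth manifolds\<close>

text \<open>A manifold is a Hausdorff second countable topological space (a whole type \<open>'m\<close>) with a
  smooth atlas modelled on \<open>real^'n\<close>; its dimension is \<open>CARD('n)\<close>.
  A chart \<open>(U, x)\<close> is a coordinate map \<open>x\<close> with domain \<open>U\<close>; values of \<open>x\<close> outside \<open>U\<close> are
  irrelevant.\<close>

type_synonym ('m, 'n) chart = "'m set \<times> ('m \<Rightarrow> real^'n)"

definition chart_inv :: "('m, 'n::finite) chart \<Rightarrow> real^'n \<Rightarrow> 'm" where
  "chart_inv c = inv_into (fst c) (snd c)"

definition smooth_atlas ::
  "('m::{t2_space, second_countable_topology}, 'n::finite) chart set \<Rightarrow> bool" where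
  "smooth_atlas A \<longleftrightarrow>
     (\<Union>c\<in>A. fst c) = UNIV \<and>
     (\<forall>c\<in>A. open (fst c) \<and> open (snd c ` fst c) \<and>
        homeomorphism (fst c) (snd c ` fst c) (snd c) (chart_inv c)) \<and>
     (\<forall>c\<in>A. \<forall>d\<in>A. smooth_on (snd c ` (fst c \<inter> fst d)) (snd d \<circ> chart_inv c))"

definition smooth_fun :: "('m, 'n::finite) chart set \<Rightarrow> ('m \<Rightarrow> real) \<Rightarrow> bool" where
  "smooth_fun A f \<longleftrightarrow> (\<forall>c\<in>A. smooth_on (snd c ` fst c) (f \<circ> chart_inv c))"

text \<open>One chart of the atlas around each point \<open>p\<close> is selected, and the tangent space at \<open>p\<close> is
  identified with \<open>real^'n\<close> through it: a tangent vector at \<open>p\<close> is given by its components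
  with respect to the coordinate basis of \<open>chart_at A p\<close>.  Its components in another chart
  \<open>c\<close> around \<open>p\<close> are \<open>components A c p v\<close>, obtained by applying the differential of the change of
  coordinates.\<close>

definition chart_at :: "('m, 'n::finite) chart set \<Rightarrow> 'm \<Rightarrow> ('m, 'n) chart" where
  "chart_at A p = (SOME c. c \<in> A \<and> p \<in> fst c)"

definition components ::
  "('m, 'n::finite) chart set \<Rightarrow> ('m, 'n) chart \<Rightarrow> 'm \<Rightarrow> real^'n \<Rightarrow> real^'n" where
  "components A c p v =
     (let d = chart_at A p in frechet_derivative (snd c \<circ> chart_inv d) (at (snd d p)) v)"

text \<open>Smooth vector fields on the whole manifold.\<close>

definition vector_field :: "('m, 'n::finite) chart set \<Rightarrow> ('m \<Rightarrow> real^'n) \<Rightarrow> bool" where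
  "vector_field A X \<longleftrightarrow>
     (\<forall>c\<in>A. smooth_on (snd c ` fst c)
        (\<lambda>y. components A c (chart_inv c y) (X (chart_inv c y))))"

text \<open>The derivative of a function \<open>f\<close> at \<open>p\<close> along the tangent vector \<open>v\<close>, and the function
  \<open>X f\<close> for a vector field \<open>X\<close>.\<close>

definition tangent_deriv ::
  "('m, 'n::finite) chart set \<Rightarrow> 'm \<Rightarrow> real^'n \<Rightarrow> ('m \<Rightarrow> real) \<Rightarrow> real" where
  "tangent_deriv A p v f =
     (let d = chart_at A p in frechet_derivative (f \<circ> chart_inv d) (at (snd d p)) v)"

definition field_deriv ::
  "('m, 'n::finite) chart set \<Rightarrow> ('m \<Rightarrow> real^'n) \<Rightarrow> ('m \<Rightarrow> real) \<Rightarrow> 'm \<Rightarrow> real" where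
  "field_deriv A X f p = tangent_deriv A p (X p) f"

text \<open>\<open>[X, Y]\<close> at \<open>p\<close> is the tangent vector acting on smooth functions by
  \<open>f \<mapsto> X (Y f) p - Y (X f) p\<close>.\<close>

definition lie_bracket ::
  "('m, 'n::finite) chart set \<Rightarrow> ('m \<Rightarrow> real^'n) \<Rightarrow> ('m \<Rightarrow> real^'n) \<Rightarrow> 'm \<Rightarrow> real^'n" where
  "lie_bracket A X Y p =
     (THE w. \<forall>f. smooth_fun A f \<longrightarrow>
        tangent_deriv A p w f =
          field_deriv A X (field_deriv A Y f) p - field_deriv A Y (field_deriv A X f) p)"


section \<open>Tensor fields\<close>

text \<open>A tensor field is a pointwise (multi)linear family that is smooth in the sense that it
  takes smooth vector fields to smooth functions or smooth vector fields.\<close>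

definition one_form :: "('m, 'n::finite) chart set \<Rightarrow> ('m \<Rightarrow> real^'n \<Rightarrow> real) \<Rightarrow> bool" where
  "one_form A \<eta> \<longleftrightarrow>
     (\<forall>p. linear (\<eta> p)) \<and>
     (\<forall>X. vector_field A X \<longrightarrow> smooth_fun A (\<lambda>p. \<eta> p (X p)))"

definition tensor_field_1_1 ::
  "('m, 'n::finite) chart set \<Rightarrow> ('m \<Rightarrow> real^'n \<Rightarrow> real^'n) \<Rightarrow> bool" where
  "tensor_field_1_1 A \<phi> \<longleftrightarrow>
     (\<forall>p. linear (\<phi> p)) \<and>
     (\<forall>X. vector_field A X \<longrightarrow> vector_field A (\<lambda>p. \<phi> p (X p)))"

definition pseudo_riemannian_metric ::
  "('m, 'n::finite) chart set \<Rightarrow> ('m \<Rightarrow> real^'n \<Rightarrow> real^'n \<Rightarrow> real) \<Rightarrow> bool" where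
  "pseudo_riemannian_metric A g \<longleftrightarrow>
     (\<forall>p. bilinear (g p)) \<and>
     (\<forall>X Y. vector_field A X \<longrightarrow> vector_field A Y \<longrightarrow> smooth_fun A (\<lambda>p. g p (X p) (Y p))) \<and>
     (\<forall>p u v. g p u v = g p v u) \<and>
     (\<forall>p u. (\<forall>v. g p u v = 0) \<longrightarrow> u = 0)"


section \<open>Connections and curvature\<close>

text \<open>A connection acts on smooth vector fields; its values on other arguments are irrelevant.\<close>

definition affine_connection ::
  "('m, 'n::finite) chart set \<Rightarrow>
   (('m \<Rightarrow> real^'n) \<Rightarrow> ('m \<Rightarrow> real^'n) \<Rightarrow> 'm \<Rightarrow> real^'n) \<Rightarrow> bool" where
  "affine_connection A nabla \<longleftrightarrow>
     (\<forall>X Y. vector_field A X \<longrightarrow> vector_field A Y \<longrightarrow> vector_field A (nabla X Y)) \<and>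
     (\<forall>X X' Y p. vector_field A X \<longrightarrow> vector_field A X' \<longrightarrow> vector_field A Y \<longrightarrow>
        nabla (\<lambda>q. X q + X' q) Y p = nabla X Y p + nabla X' Y p) \<and>
     (\<forall>f X Y p. smooth_fun A f \<longrightarrow> vector_field A X \<longrightarrow> vector_field A Y \<longrightarrow>
        nabla (\<lambda>q. f q *\<^sub>R X q) Y p = f p *\<^sub>R nabla X Y p) \<and>
     (\<forall>X Y Y' p. vector_field A X \<longrightarrow> vector_field A Y \<longrightarrow> vector_field A Y' \<longrightarrow>
        nabla X (\<lambda>q. Y q + Y' q) p = nabla X Y p + nabla X Y' p) \<and>
     (\<forall>f X Y p. smooth_fun A f \<longrightarrow> vector_field A X \<longrightarrow> vector_field A Y \<longrightarrow>
        nabla X (\<lambda>q. f q *\<^sub>R Y q) p = field_deriv A X f p *\<^sub>R Y p + f p *\<^sub>R nabla X Y p)"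

definition levi_civita_connection ::
  "('m, 'n::finite) chart set \<Rightarrow> ('m \<Rightarrow> real^'n \<Rightarrow> real^'n \<Rightarrow> real) \<Rightarrow>
   (('m \<Rightarrow> real^'n) \<Rightarrow> ('m \<Rightarrow> real^'n) \<Rightarrow> 'm \<Rightarrow> real^'n) \<Rightarrow> bool" where
  "levi_civita_connection A g nabla \<longleftrightarrow>
     affine_connection A nabla \<and>
     (\<forall>X Y p. vector_field A X \<longrightarrow> vector_field A Y \<longrightarrow>
        nabla X Y p - nabla Y X p = lie_bracket A X Y p) \<and>
     (\<forall>X Y Z p. vector_field A X \<longrightarrow> vector_field A Y \<longrightarrow> vector_field A Z \<longrightarrow>
        field_deriv A X (\<lambda>q. g q (Y q) (Z q)) p =
          g p (nabla X Y p) (Z p) + g p (Y p) (nabla X Z p))"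

definition curvature ::
  "('m, 'n::finite) chart set \<Rightarrow> (('m \<Rightarrow> real^'n) \<Rightarrow> ('m \<Rightarrow> real^'n) \<Rightarrow> 'm \<Rightarrow> real^'n) \<Rightarrow>
   ('m \<Rightarrow> real^'n) \<Rightarrow> ('m \<Rightarrow> real^'n) \<Rightarrow> ('m \<Rightarrow> real^'n) \<Rightarrow> 'm \<Rightarrow> real^'n" where
  "curvature A nabla X Y Z p =
     nabla X (nabla Y Z) p - nabla Y (nabla X Z) p - nabla (lie_bracket A X Y) Z p"

text \<open>\<open>Ric Y Z\<close> at \<open>p\<close> is the trace of the endomorphism \<open>X\<^sub>p \<mapsto> (R(X, Y) Z)\<^sub>p\<close> of the tangent space,
  which exists and is unique since \<open>R(X, Y) Z\<close> is tensorial in \<open>X\<close> and every tangent vector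
  extends to a vector field.\<close>

definition Ricci ::
  "('m, 'n::finite) chart set \<Rightarrow> (('m \<Rightarrow> real^'n) \<Rightarrow> ('m \<Rightarrow> real^'n) \<Rightarrow> 'm \<Rightarrow> real^'n) \<Rightarrow>
   ('m \<Rightarrow> real^'n) \<Rightarrow> ('m \<Rightarrow> real^'n) \<Rightarrow> 'm \<Rightarrow> real" where
  "Ricci A nabla Y Z p =
     trace (matrix (THE F. linear F \<and>
       (\<forall>X. vector_field A X \<longrightarrow> F (X p) = curvature A nabla X Y Z p)))"

text \<open>Covariant derivatives \<open>(\<nabla>\<^sub>X \<phi>) Y\<close> of a \<open>(1,1)\<close>-tensor field and \<open>(\<nabla>\<^sub>X T)(Y, Z)\<close> of a
  \<open>(0,2)\<close>-tensor field, the latter given as a function of two vector fields.\<close>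

definition nabla_1_1 ::
  "(('m \<Rightarrow> real^'n) \<Rightarrow> ('m \<Rightarrow> real^'n) \<Rightarrow> 'm \<Rightarrow> real^'n) \<Rightarrow> ('m \<Rightarrow> real^'n) \<Rightarrow>
   ('m \<Rightarrow> real^'n \<Rightarrow> real^'n) \<Rightarrow> ('m \<Rightarrow> real^'n::finite) \<Rightarrow> 'm \<Rightarrow> real^'n" where
  "nabla_1_1 nabla X \<phi> Y p = nabla X (\<lambda>q. \<phi> q (Y q)) p - \<phi> p (nabla X Y p)"

definition nabla_0_2 ::
  "('m, 'n::finite) chart set \<Rightarrow> (('m \<Rightarrow> real^'n) \<Rightarrow> ('m \<Rightarrow> real^'n) \<Rightarrow> 'm \<Rightarrow> real^'n) \<Rightarrow>
   ('m \<Rightarrow> real^'n) \<Rightarrow> (('m \<Rightarrow> real^'n) \<Rightarrow> ('m \<Rightarrow> real^'n) \<Rightarrow> 'm \<Rightarrow> real) \<Rightarrow>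
   ('m \<Rightarrow> real^'n) \<Rightarrow> ('m \<Rightarrow> real^'n) \<Rightarrow> 'm \<Rightarrow> real" where
  "nabla_0_2 A nabla X T Y Z p =
     field_deriv A X (T Y Z) p - T (nabla X Y) Z p - T Y (nabla X Z) p"


section \<open>Almost paracontact metric structures\<close>

text \<open>A paracomplex structure on a subspace \<open>V\<close>: an involutive endomorphism whose eigenspaces
  for \<open>1\<close> and \<open>-1\<close> have the same dimension.\<close>

definition paracomplex_structure_on ::
  "'a::euclidean_space set \<Rightarrow> ('a \<Rightarrow> 'a) \<Rightarrow> bool" where
  "paracomplex_structure_on V J \<longleftrightarrow>
     J ` V \<subseteq> V \<and> (\<forall>v\<in>V. J (J v) = v) \<and>
     dim {v\<in>V. J v = v} = dim {v\<in>V. J v = - v}"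

definition almost_paracontact_metric_manifold ::
  "('m::{t2_space, second_countable_topology}, 'n::finite) chart set \<Rightarrow>
   ('m \<Rightarrow> real^'n \<Rightarrow> real^'n) \<Rightarrow> ('m \<Rightarrow> real^'n \<Rightarrow> real) \<Rightarrow> ('m \<Rightarrow> real^'n) \<Rightarrow>
   ('m \<Rightarrow> real^'n \<Rightarrow> real^'n \<Rightarrow> real) \<Rightarrow> bool" where
  "almost_paracontact_metric_manifold A \<phi> \<eta> \<xi> g \<longleftrightarrow>
     smooth_atlas A \<and> (\<exists>n\<ge>1. CARD('n) = 2 * n + 1) \<and>
     tensor_field_1_1 A \<phi> \<and> one_form A \<eta> \<and> vector_field A \<xi> \<and> pseudo_riemannian_metric A g \<and>
     (\<forall>p. \<phi> p (\<xi> p) = 0) \<and>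
     (\<forall>p v. \<eta> p (\<phi> p v) = 0) \<and>
     (\<forall>p. \<eta> p (\<xi> p) = 1) \<and>
     (\<forall>p v. \<phi> p (\<phi> p v) = v - \<eta> p v *\<^sub>R \<xi> p) \<and>
     (\<forall>p. paracomplex_structure_on {v. \<eta> p v = 0} (\<phi> p)) \<and>
     (\<forall>p u v. g p (\<phi> p u) (\<phi> p v) = - g p u v + \<eta> p u * \<eta> p v)"

definition quasi_para_sasakian_manifold ::
  "('m::{t2_space, second_countable_topology}, 'n::finite) chart set \<Rightarrow>
   ('m \<Rightarrow> real^'n \<Rightarrow> real^'n) \<Rightarrow> ('m \<Rightarrow> real^'n \<Rightarrow> real) \<Rightarrow> ('m \<Rightarrow> real^'n) \<Rightarrow>
   ('m \<Rightarrow> real^'n \<Rightarrow> real^'n \<Rightarrow> real) \<Rightarrow>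
   (('m \<Rightarrow> real^'n) \<Rightarrow> ('m \<Rightarrow> real^'n) \<Rightarrow> 'm \<Rightarrow> real^'n) \<Rightarrow> bool" where
  "quasi_para_sasakian_manifold A \<phi> \<eta> \<xi> g nabla \<longleftrightarrow>
     almost_paracontact_metric_manifold A \<phi> \<eta> \<xi> g \<and>
     levi_civita_connection A g nabla \<and>
     (\<forall>X Y p. vector_field A X \<longrightarrow> vector_field A Y \<longrightarrow>
        nabla_1_1 nabla X \<phi> Y p = g p (X p) (Y p) *\<^sub>R \<xi> p - \<eta> p (Y p) *\<^sub>R X p)"

definition eta_parallel_Ricci ::
  "('m, 'n::finite) chart set \<Rightarrow> ('m \<Rightarrow> real^'n \<Rightarrow> real^'n) \<Rightarrow>
   (('m \<Rightarrow> real^'n) \<Rightarrow> ('m \<Rightarrow> real^'n) \<Rightarrow> 'm \<Rightarrow> real^'n) \<Rightarrow> bool" where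
  "eta_parallel_Ricci A \<phi> nabla \<longleftrightarrow>
     (\<forall>X Y Z p. vector_field A X \<longrightarrow> vector_field A Y \<longrightarrow> vector_field A Z \<longrightarrow>
        nabla_0_2 A nabla X (Ricci A nabla) (\<lambda>q. \<phi> q (Y q)) (\<lambda>q. \<phi> q (Z q)) p = 0)"

end

(*
  From the defining equation, nabla_X xi = phi X, hence R(X, Y) xi = eta(X) Y - eta(Y) X and
  Ric(Y, xi) = -2 eta(Y).  In dimension 3 the fibre of ker eta is spanned by two isotropic eigenvectors
  a, b of phi (eigenvalues 1 and -1), and computing traces in the frame a, b, xi gives
  Ric(a, a) = Ric(b, b) = 0 and Ric(xi, a) = Ric(xi, b) = 0, that is, Ric(Y, phi X) + Ric(phi Y, X) = 0.
  Since eta-parallelism kills the purely horizontal part of nabla Ric,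
    (nabla_X Ric)(Y, Z) = eta(Z) (nabla_X Ric)(Y, xi) + eta(Y) (nabla_X Ric)(xi, Z),
  where (nabla_X Ric)(Y, xi) = -2 g(Y, phi X) - Ric(Y, phi X) and likewise for (xi, Y).  In the cyclic
  sum the coefficient of eta(Z) is (nabla_X Ric)(Y, xi) + (nabla_Y Ric)(xi, X), which vanishes by the
  skewness of g(Y, phi X) and of Ric(Y, phi X).
*)

theory Submission
  imports Defs
begin

text \<open>Brackets and the Ricci tensor are definite descriptions over global fields and
  functions, so the geometric argument can only start once these descriptions are known to denote.
  For the bracket, existence rests on the symmetry of second derivatives and uniqueness on a supply
  of global test functions. For Ricci, existence rests on tensoriality in the first curvature
  argument and uniqueness on extending a tangent vector to a global field. All global objects come
  from a bump function supported inside one chart. Since a global frame need not exist, the proof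
  works with fields \<open>E i\<close> and forms \<open>\<theta> i\<close> that are dual only up to
  a function \<psi> with \<psi>(p) nonzero, and divides by \<psi> afterwards.\<close>

section \<open>Calculus of smooth maps\<close>

lemma frechet_derivative_eq:
  "(f has_derivative f') (at x) \<Longrightarrow> frechet_derivative f (at x) = f'"
  using frechet_derivative_at by metis

text \<open>Openness makes \<open>S\<close> a neighbourhood of each of its points, so agreement on
  \<open>S\<close> passes to the derivatives and the induction can continue.\<close>

lemma Ck_on_cong_imp:
  assumes "open S" "\<And>x. x \<in> S \<Longrightarrow> f x = g x" "Ck_on k f S"
  shows "Ck_on k g S"
  using assms(2,3)
proof (induction k arbitrary: f g)
  case 0
  then show ?case by (simp add: continuous_on_eq)
next
  case (Suc k)
  have d: "(g has_derivative frechet_derivative f (at x)) (at x)" if "x \<in> S" for x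
    using Suc.prems that assms(1)
    by (metis Ck_on.simps(2) frechet_derivative_works has_derivative_transform_within_open)
  then have e: "frechet_derivative g (at x) = frechet_derivative f (at x)" if "x \<in> S" for x
    using that frechet_derivative_eq by blast
  have "Ck_on k (\<lambda>x. frechet_derivative g (at x) v) S" for v
    by (rule Suc.IH[of "\<lambda>x. frechet_derivative f (at x) v"]) (use Suc.prems e in auto)
  with d show ?case
    by (auto intro: differentiableI)
qed

lemma Ck_on_cong:
  assumes "open S" "\<And>x. x \<in> S \<Longrightarrow> f x = g x"
  shows "Ck_on k f S \<longleftrightarrow> Ck_on k g S"
  using Ck_on_cong_imp[OF assms(1), of f g k] Ck_on_cong_imp[OF assms(1), of g f k] assms(2) by auto

lemma Ck_on_SucI:
  assumes "open S" "\<And>x. x \<in> S \<Longrightarrow> (f has_derivative D x) (at x)" "\<And>v. Ck_on k (\<lambda>x. D x v) S"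
  shows "Ck_on (Suc k) f S"
proof -
  have "Ck_on k (\<lambda>x. frechet_derivative f (at x) v) S" for v
    using assms by (intro Ck_on_cong_imp[OF assms(1) _ assms(3)[of v]]) (simp add: frechet_derivative_eq[OF assms(2)])
  then show ?thesis using assms(2) by (auto intro: differentiableI)
qed

lemma Ck_on_subset: "Ck_on k f S \<Longrightarrow> T \<subseteq> S \<Longrightarrow> Ck_on k f T"
  by (induction k arbitrary: f) (auto intro: continuous_on_subset)

lemma Ck_on_Un:
  "open S \<Longrightarrow> open T \<Longrightarrow> Ck_on k f S \<Longrightarrow> Ck_on k f T \<Longrightarrow> Ck_on k f (S \<union> T)"
  by (induction k arbitrary: f) (auto intro: continuous_on_open_Un)

text \<open>The recursion asks for continuity only at the top order. At the lower orders continuity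
  comes from differentiability, which is the base case.\<close>

lemma Ck_on_SucD: "Ck_on (Suc k) f S \<Longrightarrow> Ck_on k f S"
proof (induction k arbitrary: f)
  case 0
  then show ?case
    by (auto intro!: continuous_at_imp_continuous_on differentiable_imp_continuous_within)
next
  case (Suc k)
  then show ?case by (metis Ck_on.simps(2))
qed

lemma Ck_on_const: "Ck_on k (\<lambda>x. c) S"
  by (induction k arbitrary: c) auto

lemma Ck_on_linear_comp:
  assumes "open S" "bounded_linear L" "Ck_on k f S"
  shows "Ck_on k (\<lambda>x. L (f x)) S"
  using assms(3)
proof (induction k arbitrary: f)
  case 0
  then show ?case
    using assms(2) by (auto intro: continuous_on_compose2[OF linear_continuous_on])
next
  case (Suc k)
  have d: "((\<lambda>x. L (f x)) has_derivative (\<lambda>v. L (frechet_derivative f (at x) v))) (at x)"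
    if "x \<in> S" for x
    using Suc.prems that
    by (auto intro!: bounded_linear.has_derivative[OF assms(2)] simp: frechet_derivative_works)
  show ?case
    using Suc by (intro Ck_on_SucI[OF assms(1) d]) auto
qed

lemma Ck_on_bounded_linear: "bounded_linear L \<Longrightarrow> Ck_on k L S"
  by (cases k) (auto simp: Ck_on_const bounded_linear_imp_differentiable linear_continuous_on
      frechet_derivative_eq[OF bounded_linear_imp_has_derivative])

lemma Ck_on_add:
  assumes "open S" "Ck_on k f S" "Ck_on k g S"
  shows "Ck_on k (\<lambda>x. f x + g x) S"
  using assms(2,3)
proof (induction k arbitrary: f g)
  case 0
  then show ?case by (simp add: continuous_on_add)
next
  case (Suc k)
  have d: "((\<lambda>x. f x + g x) has_derivative
      (\<lambda>v. frechet_derivative f (at x) v + frechet_derivative g (at x) v)) (at x)"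
    if "x \<in> S" for x
    using Suc.prems that
    by (auto intro!: has_derivative_add simp: frechet_derivative_works)
  show ?case
    using Suc by (intro Ck_on_SucI[OF assms(1) d]) auto
qed

lemma Ck_on_sum:
  "open S \<Longrightarrow> (\<And>i. i \<in> I \<Longrightarrow> Ck_on k (f i) S) \<Longrightarrow> Ck_on k (\<lambda>x. \<Sum>i\<in>I. f i x) S"
  by (induction I rule: infinite_finite_induct) (auto simp: Ck_on_const Ck_on_add)

text \<open>The Leibniz rule yields products of the same shape with one factor differentiated, so
  the induction varies both factors. The undifferentiated factor is lowered to order
  \<open>k\<close> by \<open>Ck_on_SucD\<close>.\<close>

lemma (in bounded_bilinear) Ck_on_prod:
  assumes "open S" "Ck_on k f S" "Ck_on k g S"
  shows "Ck_on k (\<lambda>x. prod (f x) (g x)) S"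
  using assms(2,3)
proof (induction k arbitrary: f g)
  case 0
  then show ?case by (simp add: continuous_on)
next
  case (Suc k)
  have d: "((\<lambda>x. prod (f x) (g x)) has_derivative
      (\<lambda>v. prod (f x) (frechet_derivative g (at x) v) + prod (frechet_derivative f (at x) v) (g x)))
      (at x)"
    if "x \<in> S" for x
    using Suc.prems that by (auto intro!: FDERIV simp: frechet_derivative_works)
  have *: "Ck_on k f S" "Ck_on k g S"
    by (rule Ck_on_SucD, rule Suc.prems)+
  have "Ck_on k (\<lambda>x. frechet_derivative f (at x) v) S"
      "Ck_on k (\<lambda>x. frechet_derivative g (at x) v) S" for v
    using Suc.prems by simp_all
  then have "Ck_on k (\<lambda>x. prod (f x) (frechet_derivative g (at x) v) +
      prod (frechet_derivative f (at x) v) (g x)) S" for v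
    by (intro Ck_on_add[OF assms(1)] Suc.IH *)
  from Ck_on_SucI[OF assms(1) d this] show ?case .
qed

text \<open>\<open>Ck_on\<close> controls derivatives in fixed directions only. This expansion
  reduces a derivative in a direction that varies with the point to finitely many fixed
  ones.\<close>

lemma linear_euclidean_expansion:
  fixes L :: "'a::euclidean_space \<Rightarrow> 'b::real_vector"
  assumes "linear L"
  shows "L w = (\<Sum>b\<in>Basis. (w \<bullet> b) *\<^sub>R L b)"
proof -
  interpret linear L by fact
  have "L w = L (\<Sum>b\<in>Basis. (w \<bullet> b) *\<^sub>R b)"
    by (simp add: euclidean_representation)
  then show ?thesis unfolding sum scaleR .
qed

text \<open>The chain rule, expanded in the basis of the middle space, turns each directional
  derivative into a sum of products. Their factors are derivatives of \<open>f\<close> and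
  compositions of a derivative of \<open>g\<close> with the same \<open>f\<close>, so the induction
  varies \<open>g\<close> alone.\<close>

lemma Ck_on_compose:
  fixes f :: "'a::real_normed_vector \<Rightarrow> 'b::euclidean_space"
  assumes "open S" "open T" "f ` S \<subseteq> T" "Ck_on k f S" "Ck_on k g T"
  shows "Ck_on k (\<lambda>x. g (f x)) S"
  using assms(4,5)
proof (induction k arbitrary: g)
  case 0
  then show ?case using assms(3) by (auto intro: continuous_on_compose2)
next
  case (Suc k)
  have f: "Ck_on k f S" "\<And>v. Ck_on k (\<lambda>x. frechet_derivative f (at x) v) S"
    and g: "\<And>v. Ck_on k (\<lambda>x. frechet_derivative g (at x) v) T"
    using Suc.prems(1) Suc.prems(2) Ck_on_SucD[OF Suc.prems(1)] by simp_all
  let ?D = "\<lambda>x v. \<Sum>b\<in>Basis. (frechet_derivative f (at x) v \<bullet> b) *\<^sub>R frechet_derivative g (at (f x)) b"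
  have d: "((\<lambda>x. g (f x)) has_derivative ?D x) (at x)" if "x \<in> S" for x
  proof -
    have fx: "(f has_derivative frechet_derivative f (at x)) (at x)"
      using Suc.prems that by (auto simp: frechet_derivative_works)
    have gx: "(g has_derivative frechet_derivative g (at (f x))) (at (f x))"
      using Suc.prems that assms(3) by (auto simp: frechet_derivative_works)
    have "?D x = frechet_derivative g (at (f x)) \<circ> frechet_derivative f (at x)"
      unfolding o_def
      by (rule ext, rule linear_euclidean_expansion[OF has_derivative_linear[OF gx], symmetric])
    with diff_chain_at[OF fx gx] show ?thesis by (simp only: o_def)
  qed
  have "Ck_on k (\<lambda>x. ?D x v) S" for v
    proof (intro Ck_on_sum bounded_bilinear.Ck_on_prod[OF bounded_bilinear_scaleR] assms(1))
      fix b :: 'b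
      show "Ck_on k (\<lambda>x. frechet_derivative f (at x) v \<bullet> b) S"
        by (rule Ck_on_linear_comp[OF assms(1) bounded_linear_inner_left f(2)])
      show "Ck_on k (\<lambda>x. frechet_derivative g (at (f x)) b) S"
        by (rule Suc.IH[OF f(1) g])
    qed
  from Ck_on_SucI[OF assms(1) d this] show ?case .
qed

text \<open>The derivative of 1/f involves only 1/f itself and the derivative of f, so order
  \<open>k\<close> of the inverse yields order \<open>Suc k\<close>.\<close>

lemma Ck_on_inverse:
  fixes f :: "'a::real_normed_vector \<Rightarrow> real"
  assumes "open S" "\<And>x. x \<in> S \<Longrightarrow> f x \<noteq> 0" "Ck_on k f S"
  shows "Ck_on k (\<lambda>x. inverse (f x)) S"
  using assms(3)
proof (induction k)
  case 0
  then show ?case using assms(2) by (auto intro!: continuous_on_inverse)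
next
  case (Suc k)
  let ?D = "\<lambda>x v. - (inverse (f x) * frechet_derivative f (at x) v * inverse (f x))"
  have d: "((\<lambda>x. inverse (f x)) has_derivative ?D x) (at x)" if "x \<in> S" for x
    using Suc.prems that assms(2)[OF that] by (intro Deriv.has_derivative_inverse) (auto simp: frechet_derivative_works)
  have i: "Ck_on k (\<lambda>x. inverse (f x)) S"
    by (rule Suc.IH[OF Ck_on_SucD[OF Suc.prems]])
  have "Ck_on k (\<lambda>x. frechet_derivative f (at x) v) S" for v
    using Suc.prems by simp
  then have "Ck_on k (\<lambda>x. ?D x v) S" for v
    by (intro Ck_on_linear_comp[OF assms(1) bounded_linear_minus[OF bounded_linear_ident]]
        bounded_bilinear.Ck_on_prod[OF bounded_bilinear_mult assms(1)] i)
  from Ck_on_SucI[OF assms(1) d this] show ?case .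
qed

lemma Ck_on_local:
  assumes "\<And>x. x \<in> S \<Longrightarrow> \<exists>U. open U \<and> x \<in> U \<and> Ck_on k f U"
  shows "Ck_on k f S"
  using assms
proof (induction k arbitrary: f)
  case 0
  then show ?case
    by (metis Ck_on.simps(1) continuous_at_imp_continuous_on continuous_on_eq_continuous_at)
next
  case (Suc k)
  show ?case unfolding Ck_on.simps(2)
  proof (intro conjI ballI allI)
    fix x assume "x \<in> S"
    then show "f differentiable at x" using Suc.prems by (metis Ck_on.simps(2))
  next
    fix v show "Ck_on k (\<lambda>x. frechet_derivative f (at x) v) S"
      by (rule Suc.IH) (metis Suc.prems Ck_on.simps(2))
  qed
qed

lemma smooth_on_cong: "open S \<Longrightarrow> (\<And>x. x \<in> S \<Longrightarrow> f x = g x) \<Longrightarrow> smooth_on S f = smooth_on S g"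
  unfolding smooth_on_def using Ck_on_cong by blast

lemma smooth_on_subset: "smooth_on S f \<Longrightarrow> T \<subseteq> S \<Longrightarrow> smooth_on T f"
  unfolding smooth_on_def using Ck_on_subset by blast

lemma smooth_on_Un: "open S \<Longrightarrow> open T \<Longrightarrow> smooth_on S f \<Longrightarrow> smooth_on T f \<Longrightarrow> smooth_on (S \<union> T) f"
  unfolding smooth_on_def using Ck_on_Un by blast

lemma smooth_on_const: "smooth_on S (\<lambda>x. c)"
  unfolding smooth_on_def using Ck_on_const by blast

lemma smooth_on_linear_comp:
  "open S \<Longrightarrow> bounded_linear L \<Longrightarrow> smooth_on S f \<Longrightarrow> smooth_on S (\<lambda>x. L (f x))"
  unfolding smooth_on_def using Ck_on_linear_comp by blast

lemma smooth_on_bounded_linear: "bounded_linear L \<Longrightarrow> smooth_on S L"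
  unfolding smooth_on_def using Ck_on_bounded_linear by blast

lemma smooth_on_add:
  "open S \<Longrightarrow> smooth_on S f \<Longrightarrow> smooth_on S g \<Longrightarrow> smooth_on S (\<lambda>x. f x + g x)"
  unfolding smooth_on_def using Ck_on_add by blast

lemma smooth_on_sum:
  "open S \<Longrightarrow> (\<And>i. i \<in> I \<Longrightarrow> smooth_on S (f i)) \<Longrightarrow> smooth_on S (\<lambda>x. \<Sum>i\<in>I. f i x)"
  unfolding smooth_on_def using Ck_on_sum[of S I] by blast

lemma (in bounded_bilinear) smooth_on_prod:
  "open S \<Longrightarrow> smooth_on S f \<Longrightarrow> smooth_on S g \<Longrightarrow> smooth_on S (\<lambda>x. prod (f x) (g x))"
  unfolding smooth_on_def using Ck_on_prod by blast

lemmas smooth_on_scaleR = bounded_bilinear.smooth_on_prod[OF bounded_bilinear_scaleR]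
lemmas smooth_on_mult = bounded_bilinear.smooth_on_prod[OF bounded_bilinear_mult]

lemma smooth_on_compose:
  fixes f :: "'a::real_normed_vector \<Rightarrow> 'b::euclidean_space"
  shows "open S \<Longrightarrow> open T \<Longrightarrow> f ` S \<subseteq> T \<Longrightarrow> smooth_on S f \<Longrightarrow> smooth_on T g \<Longrightarrow>
    smooth_on S (\<lambda>x. g (f x))"
  unfolding smooth_on_def using Ck_on_compose by blast

lemma smooth_on_inverse:
  fixes f :: "'a::real_normed_vector \<Rightarrow> real"
  shows "open S \<Longrightarrow> (\<And>x. x \<in> S \<Longrightarrow> f x \<noteq> 0) \<Longrightarrow> smooth_on S f \<Longrightarrow> smooth_on S (\<lambda>x. inverse (f x))"
  unfolding smooth_on_def using Ck_on_inverse by blast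

lemma smooth_on_local:
  "(\<And>x. x \<in> S \<Longrightarrow> \<exists>U. open U \<and> x \<in> U \<and> smooth_on U f) \<Longrightarrow> smooth_on S f"
  unfolding smooth_on_def using Ck_on_local by (metis (no_types, lifting))

lemma smooth_on_has_derivative:
  "smooth_on S f \<Longrightarrow> x \<in> S \<Longrightarrow> (f has_derivative frechet_derivative f (at x)) (at x)"
  unfolding smooth_on_def frechet_derivative_works[symmetric] by (meson Ck_on.simps(2))

lemma smooth_on_frechet_derivative: "smooth_on S f \<Longrightarrow> smooth_on S (\<lambda>x. frechet_derivative f (at x) v)"
  unfolding smooth_on_def by (metis Ck_on.simps(2))

lemma smooth_on_frechet_derivative_field:
  fixes f :: "'a::euclidean_space \<Rightarrow> 'b::real_normed_vector"
  assumes "open S" "smooth_on S f" "smooth_on S v"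
  shows "smooth_on S (\<lambda>x. frechet_derivative f (at x) (v x))"
proof -
  have "smooth_on S (\<lambda>x. \<Sum>b\<in>Basis. (v x \<bullet> b) *\<^sub>R frechet_derivative f (at x) b)"
    by (intro smooth_on_sum smooth_on_scaleR assms smooth_on_frechet_derivative
        smooth_on_linear_comp[OF _ bounded_linear_inner_left])
  moreover have "frechet_derivative f (at x) (v x) =
      (\<Sum>b\<in>Basis. (v x \<bullet> b) *\<^sub>R frechet_derivative f (at x) b)" if "x \<in> S" for x
    by (rule linear_euclidean_expansion[OF has_derivative_linear[OF smooth_on_has_derivative[OF assms(2) that]]])
  ultimately show ?thesis
    using smooth_on_cong[OF assms(1)] by (metis (no_types, lifting))
qed

text \<open>Product rule for differentiating \<open>f\<close> along the varying direction
  \<open>v\<close>. In the first summand \<open>v\<close> is frozen at \<open>x\<close>, which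
  leaves a pure second derivative; it is this summand that cancels in a commutator of
  fields.\<close>

lemma frechet_derivative_frechet_derivative_field:
  fixes f :: "'a::euclidean_space \<Rightarrow> 'b::real_normed_vector"
  assumes S: "open S" "x \<in> S" and f: "smooth_on S f" and v: "smooth_on S v"
  shows "frechet_derivative (\<lambda>x. frechet_derivative f (at x) (v x)) (at x) u =
    frechet_derivative (\<lambda>y. frechet_derivative f (at y) (v x)) (at x) u +
    frechet_derivative f (at x) (frechet_derivative v (at x) u)"
proof -
  let ?D = "\<lambda>b x. frechet_derivative f (at x) b"
  have lin: "linear (frechet_derivative f (at y))" if "y \<in> S" for y
    using smooth_on_has_derivative[OF f that] by (rule has_derivative_linear)
  have D: "(?D b has_derivative frechet_derivative (?D b) (at x)) (at x)" for b
    by (rule smooth_on_has_derivative[OF smooth_on_frechet_derivative[OF f] S(2)])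
  have V: "(v has_derivative frechet_derivative v (at x)) (at x)"
    by (rule smooth_on_has_derivative[OF v S(2)])
  have "((\<lambda>x. \<Sum>b\<in>Basis. (v x \<bullet> b) *\<^sub>R ?D b x) has_derivative
      (\<lambda>u. \<Sum>b\<in>Basis. (v x \<bullet> b) *\<^sub>R frechet_derivative (?D b) (at x) u +
        (frechet_derivative v (at x) u \<bullet> b) *\<^sub>R ?D b x)) (at x)"
    by (intro has_derivative_sum has_derivative_scaleR has_derivative_inner_left V D)
  then have "((\<lambda>x. ?D (v x) x) has_derivative
      (\<lambda>u. \<Sum>b\<in>Basis. (v x \<bullet> b) *\<^sub>R frechet_derivative (?D b) (at x) u +
        (frechet_derivative v (at x) u \<bullet> b) *\<^sub>R ?D b x)) (at x)"
    by (rule has_derivative_transform_within_open[OF _ S])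
      (rule linear_euclidean_expansion[OF lin, symmetric])
  note 1 = frechet_derivative_eq[OF this]
  have "((\<lambda>y. \<Sum>b\<in>Basis. (v x \<bullet> b) *\<^sub>R ?D b y) has_derivative
      (\<lambda>u. \<Sum>b\<in>Basis. (v x \<bullet> b) *\<^sub>R frechet_derivative (?D b) (at x) u)) (at x)"
    by (intro has_derivative_sum has_derivative_scaleR_right D)
  then have "((\<lambda>y. ?D (v x) y) has_derivative
      (\<lambda>u. \<Sum>b\<in>Basis. (v x \<bullet> b) *\<^sub>R frechet_derivative (?D b) (at x) u)) (at x)"
    by (rule has_derivative_transform_within_open[OF _ S])
      (rule linear_euclidean_expansion[OF lin, symmetric])
  note 2 = frechet_derivative_eq[OF this]
  show ?thesis
    unfolding 1 2 sum.distrib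
    by (simp only: linear_euclidean_expansion[OF lin[OF S(2)], of "frechet_derivative v (at x) u"])
qed

section \<open>A flat function and smooth bumps\<close>

lemma smooth_on_realI:
  fixes f :: "real \<Rightarrow> real"
  assumes "\<And>n x. (D n has_real_derivative D (Suc n) x) (at x)" "D 0 = f"
  shows "smooth_on UNIV f"
proof -
  \<comment> \<open>All members of the sequence are treated at once, because the derivative of
    \<open>D n\<close> is a multiple of \<open>D (Suc n)\<close>.\<close>
  have "Ck_on k (D n) UNIV" for k n
  proof (induction k arbitrary: n)
    case 0
    then show ?case using assms(1)
      by (auto intro!: continuous_at_imp_continuous_on DERIV_isCont)
  next
    case (Suc k)
    have d: "(D n has_derivative (*) (D (Suc n) x)) (at x)" for x
      using assms(1) by (simp add: has_field_derivative_def)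
    have "Ck_on k (\<lambda>x. D (Suc n) x * v) UNIV" for v
      by (rule Ck_on_linear_comp[OF open_UNIV bounded_linear_mult_left Suc])
    then show ?case by (rule Ck_on_SucI[OF open_UNIV d])
  qed
  then show ?thesis unfolding smooth_on_def assms(2)[symmetric] by simp
qed

text \<open>The functions P(1/t) exp(-1/t), extended by 0 to t \<le> 0, are closed under
  differentiation: with u = 1/t the derivative is u^2 (P(u) - P'(u)) exp(-u), and
  \<open>[:0,0,1:]\<close> is the polynomial u^2. At 0 everything rests on the exponential
  dominating polynomials.\<close>

lemma flat_function_derivative:
  fixes P :: "real poly"
  defines "h \<equiv> \<lambda>P t. if t > 0 then poly P (inverse t) * exp (- inverse t) else (0::real)"
  shows "(h P has_real_derivative h ([:0,0,1:] * (P - pderiv P)) x) (at x)"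
proof -
  have lim: "((\<lambda>t. h Q t) \<longlongrightarrow> 0) (at_right 0)" for Q
  proof -
    have "((\<lambda>u. poly Q u * exp (- u)) \<longlongrightarrow> 0) at_top"
    proof -
      have "((\<lambda>u. \<Sum>i\<le>degree Q. coeff Q i * (u ^ i / exp u)) \<longlongrightarrow> (\<Sum>i\<le>degree Q. coeff Q i * 0)) at_top"
        by (intro tendsto_intros tendsto_power_div_exp_0)
      then show ?thesis
        by (simp add: poly_altdef sum_distrib_right exp_minus divide_inverse mult.assoc)
    qed
    then have "((\<lambda>t. poly Q (inverse t) * exp (- inverse t)) \<longlongrightarrow> 0) (at_right 0)"
      using filterlim_compose filterlim_inverse_at_top_right by blast
    then show ?thesis
      by (rule Lim_transform_eventually) (simp add: h_def eventually_at_filter)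
  qed
  consider "x > 0" | "x < 0" | "x = 0" by linarith
  then show ?thesis
  proof cases
    case 1
    have "((\<lambda>t. poly P (inverse t) * exp (- inverse t)) has_real_derivative 
        h ([:0,0,1:] * (P - pderiv P)) x) (at x)"
    proof -
      have i: "(inverse has_real_derivative - (inverse x * inverse x)) (at x)"
        using 1 DERIV_inverse[of x] by (simp add: power2_eq_square)
      have e: "((\<lambda>t. exp (- inverse t)) has_real_derivative exp (- inverse x) * (inverse x * inverse x)) (at x)"
        using DERIV_chain2[OF DERIV_exp DERIV_minus[OF i]] by simp
      show ?thesis
        using 1 DERIV_mult[OF DERIV_chain2[OF poly_DERIV i] e, of P]
        by (simp add: h_def algebra_simps)
    qed
    then show ?thesis
      by (rule has_field_derivative_transform_within_open[of _ _ _ "{0<..}"]) (use 1 in \<open>auto simp: h_def\<close>)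
  next
    case 2
    have "((\<lambda>t. 0) has_real_derivative h ([:0,0,1:] * (P - pderiv P)) x) (at x)"
      using 2 by (auto simp: h_def)
    then show ?thesis
      by (rule has_field_derivative_transform_within_open[of _ _ _ "{..<0}"]) (use 2 in \<open>auto simp: h_def\<close>)
  next
    case 3
    have l: "((\<lambda>t. h P t / t) \<longlongrightarrow> 0) (at_left 0)"
      by (rule Lim_transform_eventually[of "\<lambda>_. 0"]) (auto simp: h_def eventually_at_filter)
    have r: "((\<lambda>t. h P t / t) \<longlongrightarrow> 0) (at_right 0)"
    \<comment> \<open>The difference quotient at 0 is again a member of the family: dividing by t
      multiplies the polynomial by u.\<close>
    proof (rule Lim_transform_eventually[OF lim[of "[:0,1:] * P"]])
      have "h ([:0,1:] * P) t = h P t / t" if "t > 0" for t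
        using that by (simp add: h_def divide_inverse mult_ac)
      then show "\<forall>\<^sub>F t in at_right 0. h ([:0,1:] * P) t = h P t / t"
        by (simp add: eventually_at_filter)
    qed
    have "((\<lambda>t. h P t / t) \<longlongrightarrow> 0) (at 0)"
      using l r filterlim_split_at by blast
    then show ?thesis
      unfolding 3 by (simp add: has_field_derivative_iff h_def)
  qed
qed

lemma smooth_step:
  obtains h :: "real \<Rightarrow> real" where "smooth_on UNIV h" "\<And>t. h t \<noteq> 0 \<longleftrightarrow> t > 0"
proof -
  define h where "h = (\<lambda>P t. if t > 0 then poly P (inverse t) * exp (- inverse t) else (0::real))"
  define D where "D = (\<lambda>n. h (((\<lambda>P. [:0,0,1:] * (P - pderiv P)) ^^ n) 1))"
  have "smooth_on UNIV (h 1)"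
  proof (rule smooth_on_realI[of D])
    show "(D n has_real_derivative D (Suc n) x) (at x)" for n x
      unfolding D_def h_def funpow.simps o_apply
      using flat_function_derivative[of "((\<lambda>P. [:0,0,1:] * (P - pderiv P)) ^^ n) 1" x] .
  qed (simp add: D_def)
  then show ?thesis
    by (intro that[of "h 1"]) (auto simp: h_def)
qed

lemma smooth_bump:
  fixes x :: "'a::euclidean_space"
  assumes "r > 0"
  shows "\<exists>b :: 'a \<Rightarrow> real. smooth_on UNIV b \<and> b x \<noteq> 0 \<and> (\<forall>y. b y \<noteq> 0 \<longrightarrow> y \<in> cball x r)"
proof -
  obtain h :: "real \<Rightarrow> real" where h: "smooth_on UNIV h" "\<And>t. h t \<noteq> 0 \<longleftrightarrow> t > 0"
    using smooth_step by metis
  \<comment> \<open>This is r^2 - |y - x|^2, positive exactly on the open ball, with differences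
    written as sums so that the smoothness rules for sums and products apply.\<close>
  define q where "q = (\<lambda>y::'a. r\<^sup>2 + (- 1) * ((y + - x) \<bullet> (y + - x)))"
  have l: "smooth_on UNIV (\<lambda>y::'a. y + - x)"
    by (rule smooth_on_add[OF _ smooth_on_bounded_linear[OF bounded_linear_ident] smooth_on_const]) simp
  have "smooth_on UNIV q"
    unfolding q_def
    by (rule smooth_on_add[OF _ smooth_on_const smooth_on_mult[OF _ smooth_on_const
            bounded_bilinear.smooth_on_prod[OF bounded_bilinear_inner _ l l]]]) simp_all
  then have "smooth_on UNIV (\<lambda>y. h (q y))"
    by (intro smooth_on_compose[OF open_UNIV open_UNIV _ _ h(1)]) simp_all
  moreover have "y \<in> cball x r" if "h (q y) \<noteq> 0" for y
  proof -
    have "(norm (y - x))\<^sup>2 < r\<^sup>2"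
      using that unfolding h(2) q_def power2_norm_eq_inner by simp
    then have "norm (y - x) < r"
      using assms by (meson less_eq_real_def power2_less_imp_less)
    then show ?thesis by (simp add: dist_norm norm_minus_commute)
  qed
  ultimately show ?thesis
    using assms by (intro exI[of _ "\<lambda>y. h (q y)"]) (simp add: h(2) q_def)
qed

section \<open>Symmetry of second derivatives\<close>

lemma has_real_derivative_along_line:
  fixes f :: "'a::real_normed_vector \<Rightarrow> real"
  assumes "f differentiable at (a + t *\<^sub>R v)"
  shows "((\<lambda>t. f (a + t *\<^sub>R v)) has_real_derivative frechet_derivative f (at (a + t *\<^sub>R v)) v) (at t)"
proof -
  have f: "(f has_derivative frechet_derivative f (at (a + t *\<^sub>R v))) (at (a + t *\<^sub>R v))"
    using assms by (simp add: frechet_derivative_works)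
  have "((\<lambda>t. a + t *\<^sub>R v) has_derivative (\<lambda>s. s *\<^sub>R v)) (at t)"
    by (auto intro!: derivative_eq_intros)
  from diff_chain_at[OF this f]
  have "((\<lambda>t. f (a + t *\<^sub>R v)) has_derivative (\<lambda>s. frechet_derivative f (at (a + t *\<^sub>R v)) (s *\<^sub>R v))) (at t)"
    by (simp add: o_def)
  moreover have "(\<lambda>s. frechet_derivative f (at (a + t *\<^sub>R v)) (s *\<^sub>R v)) =
      (*) (frechet_derivative f (at (a + t *\<^sub>R v)) v)"
    using linear_scale[OF has_derivative_linear[OF f]] by (simp add: fun_eq_iff)
  ultimately show ?thesis by (simp add: has_field_derivative_def)
qed

text \<open>The second difference over the parallelogram spanned by \<open>h *\<^sub>R u\<close> and
  \<open>h *\<^sub>R v\<close> is evaluated by two applications of the mean value theorem: along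
  \<open>u\<close> to the difference of \<open>f\<close> on opposite sides, and along
  \<open>v\<close> to the resulting derivative. The bound on \<open>h\<close> keeps the
  parallelogram inside the ball.\<close>

lemma second_difference_mvt:
  fixes f :: "'a::real_normed_vector \<Rightarrow> real"
  assumes h: "h > 0" "h * (norm u + norm v) < d"
    and f: "\<And>y. y \<in> ball x d \<Longrightarrow> f differentiable at y"
    and Df: "\<And>y. y \<in> ball x d \<Longrightarrow> (\<lambda>y. frechet_derivative f (at y) u) differentiable at y"
  shows "\<exists>y\<in>ball x d. f (x + h *\<^sub>R u + h *\<^sub>R v) - f (x + h *\<^sub>R u) - (f (x + h *\<^sub>R v) - f x)
    = h * h * frechet_derivative (\<lambda>y. frechet_derivative f (at y) u) (at y) v"
proof -
  let ?D = "\<lambda>y. frechet_derivative f (at y) u"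
  have inb: "x + s *\<^sub>R u + t *\<^sub>R v \<in> ball x d" if "0 \<le> s" "s \<le> h" "0 \<le> t" "t \<le> h" for s t
  proof -
    have "norm (s *\<^sub>R u + t *\<^sub>R v) \<le> h * norm u + h * norm v"
      using that by (intro norm_triangle_le add_mono) (auto intro!: mult_right_mono)
    also have "\<dots> < d" using h by (simp add: algebra_simps)
    moreover have "x - (x + s *\<^sub>R u + t *\<^sub>R v) = - (s *\<^sub>R u + t *\<^sub>R v)" by simp
    ultimately show ?thesis by (simp only: mem_ball dist_norm norm_minus_cancel)
  qed
  have "\<exists>s>0. s < h \<and> (f (x + h *\<^sub>R v + h *\<^sub>R u) - f (x + h *\<^sub>R u)) - (f (x + h *\<^sub>R v + 0 *\<^sub>R u) - f (x + 0 *\<^sub>R u))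
    = (h - 0) * (?D (x + h *\<^sub>R v + s *\<^sub>R u) - ?D (x + s *\<^sub>R u))"
  proof (rule MVT2[OF h(1)])
    fix s assume s: "0 \<le> s" "s \<le> h"
    show "((\<lambda>s. f (x + h *\<^sub>R v + s *\<^sub>R u) - f (x + s *\<^sub>R u)) has_real_derivative
        ?D (x + h *\<^sub>R v + s *\<^sub>R u) - ?D (x + s *\<^sub>R u)) (at s)"
      using inb[OF s, of h] inb[OF s, of 0] h
      by (intro DERIV_diff has_real_derivative_along_line f) (simp_all add: algebra_simps)
  qed
  then obtain s where s: "0 < s" "s < h"
    "f (x + h *\<^sub>R v + h *\<^sub>R u) - f (x + h *\<^sub>R u) - (f (x + h *\<^sub>R v) - f x)
      = h * (?D (x + h *\<^sub>R v + s *\<^sub>R u) - ?D (x + s *\<^sub>R u))"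
    by auto
  have "\<exists>t>0. t < h \<and> ?D (x + s *\<^sub>R u + h *\<^sub>R v) - ?D (x + s *\<^sub>R u + 0 *\<^sub>R v)
    = (h - 0) * frechet_derivative ?D (at (x + s *\<^sub>R u + t *\<^sub>R v)) v"
    by (rule MVT2[OF h(1)], rule has_real_derivative_along_line, rule Df, rule inb) (use s in auto)
  then obtain t where t: "0 < t" "t < h"
    "?D (x + s *\<^sub>R u + h *\<^sub>R v) - ?D (x + s *\<^sub>R u) =
      h * frechet_derivative ?D (at (x + s *\<^sub>R u + t *\<^sub>R v)) v"
    by auto
  have c: "x + h *\<^sub>R v + s *\<^sub>R u = x + s *\<^sub>R u + h *\<^sub>R v"
    "x + h *\<^sub>R v + h *\<^sub>R u = x + h *\<^sub>R u + h *\<^sub>R v" by simp_all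
  show ?thesis
  proof
    show "x + s *\<^sub>R u + t *\<^sub>R v \<in> ball x d" using inb s t by simp
    show "f (x + h *\<^sub>R u + h *\<^sub>R v) - f (x + h *\<^sub>R u) - (f (x + h *\<^sub>R v) - f x) =
        h * h * frechet_derivative ?D (at (x + s *\<^sub>R u + t *\<^sub>R v)) v"
      using s(3) t(3) unfolding c by (simp only: mult.assoc)
  qed
qed

text \<open>The second difference is symmetric in \<open>u\<close> and \<open>v\<close>, so the two
  mixed derivatives take a common value at two points \<open>y\<close> and \<open>z\<close> near
  \<open>x\<close>. Their continuity carries the equality to \<open>x\<close> up to an arbitrary
  error.\<close>

lemma second_derivative_symmetric:
  fixes f :: "'a::real_normed_vector \<Rightarrow> real"
  assumes S: "open S" "x \<in> S" and f: "Ck_on (Suc (Suc 0)) f S"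
  shows "frechet_derivative (\<lambda>y. frechet_derivative f (at y) u) (at x) v =
    frechet_derivative (\<lambda>y. frechet_derivative f (at y) v) (at x) u"
proof -
  define DD where "DD = (\<lambda>u v y. frechet_derivative (\<lambda>y. frechet_derivative f (at y) u) (at y) v)"
  have cont: "continuous_on S (DD u v)" for u v
    using f by (simp add: DD_def)
  have "\<bar>DD u v x - DD v u x\<bar> \<le> e" if e: "e > 0" for e
  proof -
    obtain d1 where d1: "d1 > 0" "\<And>y. y \<in> S \<Longrightarrow> dist y x < d1 \<Longrightarrow> dist (DD u v y) (DD u v x) < e / 2"
      using continuous_on_iff[THEN iffD1, OF cont, rule_format, OF S(2), of "e/2"] e by fastforce
    obtain d2 where d2: "d2 > 0" "\<And>y. y \<in> S \<Longrightarrow> dist y x < d2 \<Longrightarrow> dist (DD v u y) (DD v u x) < e / 2"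
      using continuous_on_iff[THEN iffD1, OF cont, rule_format, OF S(2), of "e/2"] e by fastforce
    obtain d3 where d3: "d3 > 0" "ball x d3 \<subseteq> S"
      using S open_contains_ball by blast
    define d where "d = min d1 (min d2 d3)"
    have d: "d > 0" using d1 d2 d3 by (simp add: d_def)
    have sub: "ball x d \<subseteq> S" using d3 by (auto simp: d_def)
    \<comment> \<open>The summand 1 keeps the denominator positive when both directions are zero and
      makes the bound by \<open>d\<close> strict.\<close>
    define h where "h = d / (norm u + norm v + 1)"
    have pos: "norm u + norm v + 1 > 0" using norm_ge_zero[of u] norm_ge_zero[of v] by linarith
    have h: "h > 0" using d pos by (simp add: h_def)
    have hd: "h * (norm u + norm v) < d" "h * (norm v + norm u) < d"
      using d pos by (simp_all add: h_def field_simps)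
    have df: "f differentiable at y" if "y \<in> ball x d" for y
      using f that sub by auto
    have dDf: "(\<lambda>y. frechet_derivative f (at y) u) differentiable at y" if "y \<in> ball x d" for y u
      using f that sub by auto
    obtain y where y: "y \<in> ball x d"
      "f (x + h *\<^sub>R u + h *\<^sub>R v) - f (x + h *\<^sub>R u) - (f (x + h *\<^sub>R v) - f x) = h * h * DD u v y"
      using second_difference_mvt[OF h hd(1) df dDf] unfolding DD_def by blast
    obtain z where z: "z \<in> ball x d"
      "f (x + h *\<^sub>R v + h *\<^sub>R u) - f (x + h *\<^sub>R v) - (f (x + h *\<^sub>R u) - f x) = h * h * DD v u z"
      using second_difference_mvt[OF h hd(2) df dDf] unfolding DD_def by blast
    have "h * h * DD u v y = h * h * DD v u z"
    proof -
      have "x + h *\<^sub>R v + h *\<^sub>R u = x + h *\<^sub>R u + h *\<^sub>R v" by simp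
      from z(2)[unfolded this] y(2) show ?thesis by linarith
    qed
    then have "DD u v y = DD v u z" using h by simp
    moreover have "\<bar>DD u v y - DD u v x\<bar> < e / 2"
      using d1(2)[of y] y(1) sub by (auto simp: d_def dist_norm norm_minus_commute)
    moreover have "\<bar>DD v u z - DD v u x\<bar> < e / 2"
      using d2(2)[of z] z(1) sub by (auto simp: d_def dist_norm norm_minus_commute)
    ultimately show ?thesis by linarith
  qed
  then have "DD u v x - DD v u x = 0"
    by (metis abs_le_zero_iff field_le_epsilon add_0)
  then show ?thesis by (simp add: DD_def)
qed

section \<open>Smooth manifolds\<close>

locale smooth_manifold =
  fixes A :: "('m::{t2_space, second_countable_topology}, 'n::finite) chart set"
  assumes atlas: "smooth_atlas A"
begin

lemma chart_at: "chart_at A p \<in> A" "p \<in> fst (chart_at A p)"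
proof -
  have "\<exists>c. c \<in> A \<and> p \<in> fst c"
    using atlas unfolding smooth_atlas_def by blast
  from someI_ex[OF this] show "chart_at A p \<in> A" "p \<in> fst (chart_at A p)"
    unfolding chart_at_def by auto
qed

lemma
  assumes "c \<in> A"
  shows open_domain: "open (fst c)" and open_codomain: "open (snd c ` fst c)"
    and chart_homeomorphism: "homeomorphism (fst c) (snd c ` fst c) (snd c) (chart_inv c)"
  using assms atlas unfolding smooth_atlas_def by auto

lemma chart_inv_left [simp]: "c \<in> A \<Longrightarrow> p \<in> fst c \<Longrightarrow> chart_inv c (snd c p) = p"
  using chart_homeomorphism homeomorphism_apply1 by metis

lemma open_chart_image:
  assumes "c \<in> A" "open U" "U \<subseteq> fst c"
  shows "open (snd c ` U)"
proof -
  have "openin (top_of_set (snd c ` fst c)) (snd c ` U)"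
    using assms by (intro homeomorphism_imp_open_map[OF chart_homeomorphism]) (auto simp: openin_open)
  then show ?thesis using open_codomain[OF assms(1)] openin_open_trans by blast
qed

lemma open_overlap: "c \<in> A \<Longrightarrow> d \<in> A \<Longrightarrow> open (snd c ` (fst c \<inter> fst d))"
  by (intro open_chart_image open_Int open_domain) auto

lemma transition_smooth:
  "c \<in> A \<Longrightarrow> d \<in> A \<Longrightarrow> smooth_on (snd c ` (fst c \<inter> fst d)) (snd d \<circ> chart_inv c)"
  using atlas unfolding smooth_atlas_def by blast

section \<open>Changes of coordinates\<close>

definition jac :: "('m, 'n) chart \<Rightarrow> ('m, 'n) chart \<Rightarrow> 'm \<Rightarrow> real^'n \<Rightarrow> real^'n" where
  "jac c d p = frechet_derivative (snd d \<circ> chart_inv c) (at (snd c p))"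

lemma components_jac: "components A c p = jac (chart_at A p) c p"
  by (simp add: components_def jac_def Let_def fun_eq_iff)

lemma jac_has_derivative:
  assumes "c \<in> A" "d \<in> A" "p \<in> fst c" "p \<in> fst d"
  shows "((snd d \<circ> chart_inv c) has_derivative jac c d p) (at (snd c p))"
  unfolding jac_def using assms by (intro smooth_on_has_derivative[OF transition_smooth]) auto

lemma linear_jac: "c \<in> A \<Longrightarrow> d \<in> A \<Longrightarrow> p \<in> fst c \<Longrightarrow> p \<in> fst d \<Longrightarrow> linear (jac c d p)"
  using jac_has_derivative has_derivative_linear by blast

lemma linear_components: "c \<in> A \<Longrightarrow> p \<in> fst c \<Longrightarrow> linear (components A c p)"
  unfolding components_jac by (intro linear_jac chart_at)

text \<open>Passing through the chart \<open>d\<close> changes nothing on the overlap of the two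
  domains, an open set, and the derivative sees no more than that. With a coordinate map for
  \<open>f\<close> this gives the cocycle rule for \<open>jac\<close>; with a scalar function it
  gives independence of the chart.\<close>

lemma chain_rule_transition:
  assumes "c \<in> A" "d \<in> A" "p \<in> fst c" "p \<in> fst d"
    and f: "((f \<circ> chart_inv d) has_derivative f') (at (snd d p))"
  shows "((f \<circ> chart_inv c) has_derivative (\<lambda>v. f' (jac c d p v))) (at (snd c p))"
proof -
  have "((f \<circ> chart_inv d) has_derivative f') (at ((snd d \<circ> chart_inv c) (snd c p)))"
    using f assms by simp
  from diff_chain_at[OF jac_has_derivative[OF assms(1-4)] this]
  have "((\<lambda>z. (f \<circ> chart_inv d) ((snd d \<circ> chart_inv c) z)) has_derivative (\<lambda>v. f' (jac c d p v))) (at (snd c p))"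
    by (simp add: o_def)
  then show ?thesis
    by (rule has_derivative_transform_within_open[OF _ open_overlap[OF assms(1,2)]]) (use assms in auto)
qed

lemma jac_compose:
  assumes "c \<in> A" "d \<in> A" "e \<in> A" "p \<in> fst c" "p \<in> fst d" "p \<in> fst e"
  shows "jac d e p (jac c d p v) = jac c e p v"
  using has_derivative_unique[OF chain_rule_transition[OF assms(1,2,4,5) jac_has_derivative[OF assms(2,3,5,6)]]
      jac_has_derivative[OF assms(1,3,4,6)]]
  by (rule fun_cong)

lemma jac_refl:
  assumes "c \<in> A" "p \<in> fst c"
  shows "jac c c p v = v"
proof -
  have "((\<lambda>x. x) has_derivative (\<lambda>x. x)) (at (snd c p))" by simp
  then have "((snd c \<circ> chart_inv c) has_derivative (\<lambda>x. x)) (at (snd c p))"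
    by (rule has_derivative_transform_within_open[OF _ open_codomain[OF assms(1)]]) (use assms in auto)
  from frechet_derivative_eq[OF this] show ?thesis by (simp add: jac_def)
qed

lemma components_chart_at: "components A (chart_at A p) p v = v"
  by (simp add: components_jac jac_refl chart_at)

lemma jac_components:
  "c \<in> A \<Longrightarrow> d \<in> A \<Longrightarrow> p \<in> fst c \<Longrightarrow> p \<in> fst d \<Longrightarrow>
    jac c d p (components A c p v) = components A d p v"
  by (simp add: components_jac jac_compose chart_at)

lemma smooth_fun_has_derivative:
  assumes "smooth_fun A f" "c \<in> A" "p \<in> fst c"
  shows "((f \<circ> chart_inv c) has_derivative frechet_derivative (f \<circ> chart_inv c) (at (snd c p))) (at (snd c p))"
  using assms unfolding smooth_fun_def by (intro smooth_on_has_derivative) auto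

text \<open>\<open>tangent_deriv\<close> uses the chart selected at \<open>p\<close>, and the
  selection may jump with \<open>p\<close>. Smoothness in \<open>p\<close> can be checked only after
  passing to a fixed chart.\<close>

lemma tangent_deriv_chart:
  assumes "smooth_fun A f" "c \<in> A" "p \<in> fst c"
  shows "tangent_deriv A p v f = frechet_derivative (f \<circ> chart_inv c) (at (snd c p)) (components A c p v)"
  unfolding tangent_deriv_def Let_def components_jac
  by (simp add: frechet_derivative_eq[OF chain_rule_transition[OF chart_at(1) assms(2) chart_at(2) assms(3)
          smooth_fun_has_derivative[OF assms]]])

lemma smooth_fun_field_deriv:
  assumes f: "smooth_fun A f" and X: "vector_field A X"
  shows "smooth_fun A (field_deriv A X f)"
  unfolding smooth_fun_def
proof
  fix c assume c: "c \<in> A"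
  have "smooth_on (snd c ` fst c) (\<lambda>y. frechet_derivative (f \<circ> chart_inv c) (at y)
      (components A c (chart_inv c y) (X (chart_inv c y))))"
    using f X c open_codomain[OF c] unfolding smooth_fun_def vector_field_def
    by (intro smooth_on_frechet_derivative_field) auto
  moreover have "(field_deriv A X f \<circ> chart_inv c) y =
      frechet_derivative (f \<circ> chart_inv c) (at y) (components A c (chart_inv c y) (X (chart_inv c y)))"
    if "y \<in> snd c ` fst c" for y
    using that c tangent_deriv_chart[OF f c] by (auto simp: field_deriv_def)
  ultimately show "smooth_on (snd c ` fst c) (field_deriv A X f \<circ> chart_inv c)"
    using smooth_on_cong[OF open_codomain[OF c]] by (metis (no_types, lifting))
qed

lemma smooth_fun_const: "smooth_fun A (\<lambda>q. a)"
  unfolding smooth_fun_def by (simp add: o_def smooth_on_const)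

lemma smooth_fun_add: "smooth_fun A f \<Longrightarrow> smooth_fun A h \<Longrightarrow> smooth_fun A (\<lambda>q. f q + h q)"
  unfolding smooth_fun_def o_def by (simp add: smooth_on_add open_codomain)

lemma smooth_fun_mult: "smooth_fun A f \<Longrightarrow> smooth_fun A h \<Longrightarrow> smooth_fun A (\<lambda>q. f q * h q)"
  unfolding smooth_fun_def o_def by (simp add: smooth_on_mult open_codomain)

lemma smooth_fun_sum:
  "(\<And>i. i \<in> I \<Longrightarrow> smooth_fun A (f i)) \<Longrightarrow> smooth_fun A (\<lambda>q. \<Sum>i\<in>I. f i q)"
  by (induction I rule: infinite_finite_induct) (auto simp: smooth_fun_const smooth_fun_add)

lemma vector_field_cong_components:
  assumes "\<And>c q. c \<in> A \<Longrightarrow> q \<in> fst c \<Longrightarrow> components A c q (X q) = h c (snd c q)"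
    and "\<And>c. c \<in> A \<Longrightarrow> smooth_on (snd c ` fst c) (h c)"
  shows "vector_field A X"
  unfolding vector_field_def
proof
  fix c assume c: "c \<in> A"
  have "smooth_on (snd c ` fst c) (h c) =
      smooth_on (snd c ` fst c) (\<lambda>y. components A c (chart_inv c y) (X (chart_inv c y)))"
    by (rule smooth_on_cong[OF open_codomain[OF c]]) (use assms(1)[OF c] c in auto)
  with assms(2)[OF c]
  show "smooth_on (snd c ` fst c) (\<lambda>y. components A c (chart_inv c y) (X (chart_inv c y)))" by simp
qed

lemma vector_field_add:
  assumes "vector_field A X" "vector_field A Y"
  shows "vector_field A (\<lambda>q. X q + Y q)"
  by (rule vector_field_cong_components[where h = "\<lambda>c y. components A c (chart_inv c y) (X (chart_inv c y)) +
        components A c (chart_inv c y) (Y (chart_inv c y))"])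
    (use assms in \<open>auto simp: linear_add[OF linear_components] vector_field_def intro!: smooth_on_add open_codomain\<close>)

lemma vector_field_scaleR:
  assumes "smooth_fun A f" "vector_field A X"
  shows "vector_field A (\<lambda>q. f q *\<^sub>R X q)"
  by (rule vector_field_cong_components[where h = "\<lambda>c y. (f \<circ> chart_inv c) y *\<^sub>R
        components A c (chart_inv c y) (X (chart_inv c y))"])
    (use assms in \<open>auto simp: linear_scale[OF linear_components] vector_field_def smooth_fun_def o_def
      intro!: smooth_on_scaleR open_codomain\<close>)

lemma vector_field_zero: "vector_field A (\<lambda>q. 0)"
  by (rule vector_field_cong_components[where h = "\<lambda>c y. 0"])
    (auto simp: linear_0[OF linear_components] smooth_on_const)

lemma vector_field_sum:
  "(\<And>i. i \<in> I \<Longrightarrow> vector_field A (X i)) \<Longrightarrow> vector_field A (\<lambda>q. \<Sum>i\<in>I. X i q)"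
  by (induction I rule: infinite_finite_induct) (auto simp: vector_field_zero vector_field_add)

section \<open>Extension by zero from a chart\<close>

lemma chart_bump:
  obtains d K and b :: "real^'n \<Rightarrow> real" where "d = chart_at A p" "closed K" "K \<subseteq> fst d"
    "smooth_on UNIV b" "b (snd d p) \<noteq> 0" "\<forall>q\<in>fst d - K. b (snd d q) = 0"
proof -
  define d where "d = chart_at A p"
  have d: "d \<in> A" "p \<in> fst d" using chart_at d_def by auto
  obtain r where r: "r > 0" "cball (snd d p) r \<subseteq> snd d ` fst d"
    using open_contains_cball[THEN iffD1, OF open_codomain[OF d(1)], rule_format, of "snd d p"] d(2) by auto
  obtain b :: "real^'n \<Rightarrow> real" where b: "smooth_on UNIV b" "b (snd d p) \<noteq> 0" "\<forall>y. b y \<noteq> 0 \<longrightarrow> y \<in> cball (snd d p) r"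
    using smooth_bump[OF r(1), of "snd d p"] by blast
  have hom: "homeomorphism (fst d) (snd d ` fst d) (snd d) (chart_inv d)"
    using chart_homeomorphism d(1) by blast
  have "compact (chart_inv d ` cball (snd d p) r)"
    using r(2) homeomorphism_cont2[OF hom] by (intro compact_continuous_image) (auto intro: continuous_on_subset)
  \<comment> \<open>The Hausdorff property enters here: \<open>K\<close> is closed in the whole
    manifold and not merely in the chart domain, so its complement is an open set on which an
    extension by zero vanishes.\<close>
  then have "closed (chart_inv d ` cball (snd d p) r)" by (rule compact_imp_closed)
  moreover have "chart_inv d ` cball (snd d p) r \<subseteq> fst d"
    using r(2) homeomorphism_image2[OF hom] by blast
  moreover have "b (snd d q) = 0" if "q \<in> fst d" "q \<notin> chart_inv d ` cball (snd d p) r" for q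
    using b(3) that d(1) by (metis chart_inv_left image_eqI)
  ultimately show ?thesis
    using that[OF d_def _ _ b(1,2), of "chart_inv d ` cball (snd d p) r"] by simp
qed

text \<open>\<open>h\<close> is the representative in an arbitrary chart \<open>c\<close> of an
  object given by \<open>G\<close> in the chart \<open>d\<close>. The domain of \<open>c\<close> is
  covered by two open sets: the overlap with \<open>d\<close>, where \<open>h\<close> is
  \<open>G\<close> composed with a transition map, and the complement of \<open>K\<close>, where
  \<open>h\<close> is zero.\<close>

lemma smooth_on_extend_zero:
  assumes c: "c \<in> A" and d: "d \<in> A" and K: "closed K" "K \<subseteq> fst d"
    and G: "smooth_on (snd d ` (fst d \<inter> fst c)) G"
    and hG: "\<And>q. q \<in> fst c \<Longrightarrow> q \<in> fst d \<Longrightarrow> h (snd c q) = G (snd d q)"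
    and h0: "\<And>q. q \<in> fst c \<Longrightarrow> q \<notin> K \<Longrightarrow> h (snd c q) = 0"
  shows "smooth_on (snd c ` fst c) h"
proof -
  let ?U = "snd c ` (fst c \<inter> fst d)" and ?V = "snd c ` (fst c - K)"
  have U: "open ?U" by (rule open_overlap[OF c d])
  have V: "open ?V" by (intro open_chart_image c open_Diff open_domain K) auto
  have "smooth_on ?U (\<lambda>y. G ((snd d \<circ> chart_inv c) y))"
    using c d by (intro smooth_on_compose[OF U open_overlap[OF d c] _ transition_smooth G]) auto
  then have 1: "smooth_on ?U h"
    by (subst (asm) smooth_on_cong[OF U, of _ h]) (use hG c in auto)
  have 2: "smooth_on ?V h"
    by (subst smooth_on_cong[OF V, of _ "\<lambda>_. 0"]) (use h0 in \<open>auto simp: smooth_on_const\<close>)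
  have "snd c ` fst c = ?U \<union> ?V" using K by blast
  then show ?thesis using smooth_on_Un[OF U V 1 2] by simp
qed

lemma smooth_fun_extend_zero:
  assumes d: "d \<in> A" and K: "closed K" "K \<subseteq> fst d" "\<And>q. q \<in> fst d \<Longrightarrow> q \<notin> K \<Longrightarrow> G (snd d q) = 0"
    and G: "smooth_on (snd d ` fst d) G"
  shows "smooth_fun A (\<lambda>q. if q \<in> fst d then G (snd d q) else 0)"
  unfolding smooth_fun_def
proof
  fix c assume c: "c \<in> A"
  show "smooth_on (snd c ` fst c) ((\<lambda>q. if q \<in> fst d then G (snd d q) else 0) \<circ> chart_inv c)"
    by (rule smooth_on_extend_zero[OF c d K(1,2), of G])
      (use c K in \<open>auto intro: smooth_on_subset[OF G]\<close>)
qed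

text \<open>The frame \<open>E\<close> and coframe \<open>\<theta>\<close> are global, but dual to each other only up to the factor \<open>\<psi>\<close>: they are
  the coordinate (co)frame of a chart multiplied by a bump function.\<close>

lemma partial_frame:
  "\<exists>(\<psi> :: 'm \<Rightarrow> real) (E :: 'n \<Rightarrow> 'm \<Rightarrow> real^'n) (\<theta> :: 'n \<Rightarrow> 'm \<Rightarrow> real^'n \<Rightarrow> real).
    smooth_fun A \<psi> \<and> \<psi> p \<noteq> 0 \<and> (\<forall>i. vector_field A (E i)) \<and> (\<forall>i. one_form A (\<theta> i)) \<and>
    (\<forall>q v. (\<Sum>i\<in>UNIV. \<theta> i q v *\<^sub>R E i q) = \<psi> q *\<^sub>R v)"
proof -
  obtain d K and b :: "real^'n \<Rightarrow> real" where d': "d = chart_at A p" and K: "closed K" "K \<subseteq> fst d"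
    and b: "smooth_on UNIV b" "b (snd d p) \<noteq> 0" "\<forall>q\<in>fst d - K. b (snd d q) = 0"
    using chart_bump[of p] by metis
  have d: "d \<in> A" "p \<in> fst d" using d' chart_at by auto
  have bS: "smooth_on S b" for S using b(1) smooth_on_subset by blast
  \<comment> \<open>The bump occurs squared because \<open>E\<close> and \<open>\<theta>\<close>
    each carry one factor of it.\<close>
  define \<psi> where "\<psi> = (\<lambda>q. if q \<in> fst d then b (snd d q) * b (snd d q) else 0)"
  \<comment> \<open>A tangent vector at \<open>q\<close> is stored in the chart selected at
    \<open>q\<close>, so the coordinate vectors of \<open>d\<close> have to be transported
    there.\<close>
  define E where "E = (\<lambda>i q. if q \<in> fst d then b (snd d q) *\<^sub>R jac d (chart_at A q) q (axis i 1) else 0)"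
  define \<theta> where "\<theta> = (\<lambda>i q v. if q \<in> fst d then b (snd d q) * components A d q v $ i else 0)"
  show ?thesis
  proof (rule exI[of _ \<psi>], rule exI[of _ E], rule exI[of _ \<theta>], intro conjI allI)
    show "smooth_fun A \<psi>"
      unfolding \<psi>_def
      by (rule smooth_fun_extend_zero[OF d(1) K, of "\<lambda>y. b y * b y"])
        (use b d in \<open>auto intro!: smooth_on_mult open_codomain bS\<close>)
    show "\<psi> p \<noteq> 0" using b d by (simp add: \<psi>_def)
    show "vector_field A (E i)" for i
      unfolding vector_field_def
    proof
      fix c assume c: "c \<in> A"
      show "smooth_on (snd c ` fst c) (\<lambda>y. components A c (chart_inv c y) (E i (chart_inv c y)))"
      proof (rule smooth_on_extend_zero[OF c d(1) K])
        show "smooth_on (snd d ` (fst d \<inter> fst c))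
            (\<lambda>z. b z *\<^sub>R frechet_derivative (snd c \<circ> chart_inv d) (at z) (axis i 1))"
          by (intro smooth_on_scaleR open_overlap c d bS smooth_on_frechet_derivative transition_smooth)
        fix q assume q: "q \<in> fst c"
        then have lin: "linear (components A c q)" by (rule linear_components[OF c])
        show "components A c (chart_inv c (snd c q)) (E i (chart_inv c (snd c q))) =
            b (snd d q) *\<^sub>R frechet_derivative (snd c \<circ> chart_inv d) (at (snd d q)) (axis i 1)"
          if "q \<in> fst d"
          using that q c d lin
          by (simp add: E_def linear_scale components_jac jac_compose chart_at) (simp add: jac_def)
        show "components A c (chart_inv c (snd c q)) (E i (chart_inv c (snd c q))) = 0" if "q \<notin> K"
          using that q c b(3) by (auto simp: E_def linear_0[OF lin])
      qed
    qed
    show "one_form A (\<theta> i)" for i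
      unfolding one_form_def
    proof (intro conjI allI impI)
      fix q
      show "linear (\<theta> i q)"
      proof (cases "q \<in> fst d")
        case True
        then show ?thesis
          using linear_components[OF d(1) True]
          by (intro linearI) (simp_all add: \<theta>_def linear_add linear_scale algebra_simps)
      next
        case False
        then show ?thesis by (intro linearI) (simp_all add: \<theta>_def)
      qed
    next
      fix X :: "'m \<Rightarrow> real^'n" assume X: "vector_field A X"
      let ?G = "\<lambda>y. b y * components A d (chart_inv d y) (X (chart_inv d y)) $ i"
      have "smooth_on (snd d ` fst d) ?G"
        using X d unfolding vector_field_def
        by (intro smooth_on_mult open_codomain bS smooth_on_linear_comp[OF _ bounded_linear_vec_nth]) auto
      then have "smooth_fun A (\<lambda>q. if q \<in> fst d then ?G (snd d q) else 0)"
        by (rule smooth_fun_extend_zero[OF d(1) K, rotated]) (simp add: b)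
      moreover have "(\<lambda>q. if q \<in> fst d then ?G (snd d q) else 0) = (\<lambda>q. \<theta> i q (X q))"
        using d by (auto simp: \<theta>_def)
      ultimately show "smooth_fun A (\<lambda>q. \<theta> i q (X q))" by simp
    qed
    show "(\<Sum>i\<in>UNIV. \<theta> i q v *\<^sub>R E i q) = \<psi> q *\<^sub>R v" for q v
    proof (cases "q \<in> fst d")
      case True
      interpret J: linear "jac d (chart_at A q) q" by (intro linear_jac d chart_at True)
      let ?w = "components A d q v"
      have "(\<Sum>i\<in>UNIV. ?w $ i *\<^sub>R jac d (chart_at A q) q (axis i 1)) = jac d (chart_at A q) q (\<Sum>i\<in>UNIV. ?w $ i *\<^sub>R axis i 1)"
        by (simp only: J.sum J.scaleR)
      also have "(\<Sum>i\<in>UNIV. ?w $ i *\<^sub>R axis i 1) = ?w"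
        using basis_expansion[of ?w] by (simp add: scalar_mult_eq_scaleR)
      also have "jac d (chart_at A q) q ?w = v"
        by (simp add: jac_components d chart_at True components_chart_at)
      finally have "(\<Sum>i\<in>UNIV. ?w $ i *\<^sub>R jac d (chart_at A q) q (axis i 1)) = v" .
      moreover have "(\<Sum>i\<in>UNIV. \<theta> i q v *\<^sub>R E i q) =
          \<psi> q *\<^sub>R (\<Sum>i\<in>UNIV. ?w $ i *\<^sub>R jac d (chart_at A q) q (axis i 1))"
        using True by (simp add: \<theta>_def E_def \<psi>_def scaleR_sum_right mult_ac)
      ultimately show ?thesis by simp
    next
      case False
      then show ?thesis by (simp add: \<theta>_def E_def \<psi>_def)
    qed
  qed
qed

section \<open>Derivations and the Lie bracket\<close>

lemma smooth_fun_differential_separates: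
  assumes "\<And>f. smooth_fun A f \<Longrightarrow> tangent_deriv A p v f = tangent_deriv A p w f"
  shows "v = w"
proof -
  obtain d K and b :: "real^'n \<Rightarrow> real" where d': "d = chart_at A p" and K: "closed K" "K \<subseteq> fst d"
    and b: "smooth_on UNIV b" "b (snd d p) \<noteq> 0" "\<forall>q\<in>fst d - K. b (snd d q) = 0"
    using chart_bump[of p] by metis
  have d: "d \<in> A" "p \<in> fst d" using d' chart_at by auto
  have bS: "smooth_on S b" for S using b(1) smooth_on_subset by blast
  have "v $ i = w $ i" for i
  proof -
    \<comment> \<open>The coordinate is shifted to vanish at \<open>p\<close>. The derivative of the
      bump then drops out, and the derivative of the product at \<open>p\<close> is a nonzero
      multiple of the i-th component.\<close>
    let ?G = "\<lambda>y. b y * (y $ i + - (snd d p $ i))"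
    let ?f = "\<lambda>q. if q \<in> fst d then ?G (snd d q) else 0"
    have op: "open (snd d ` fst d)" using d open_codomain by blast
    have "smooth_on (snd d ` fst d) ?G"
      by (intro smooth_on_mult[OF op bS] smooth_on_add[OF op] smooth_on_const
          smooth_on_bounded_linear bounded_linear_vec_nth)
    then have f: "smooth_fun A ?f"
      by (rule smooth_fun_extend_zero[OF d(1) K, rotated]) (simp add: b)
    have "(b has_derivative frechet_derivative b (at (snd d p))) (at (snd d p))"
      using b(1) by (intro smooth_on_has_derivative[of UNIV]) auto
    then have "(?G has_derivative (\<lambda>h. b (snd d p) * h $ i)) (at (snd d p))"
      by (auto intro!: derivative_eq_intros bounded_linear.has_derivative[OF bounded_linear_vec_nth])
    then have "((?f \<circ> chart_inv d) has_derivative (\<lambda>h. b (snd d p) * h $ i)) (at (snd d p))"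
      by (rule has_derivative_transform_within_open[OF _ op]) (use d in auto)
    from frechet_derivative_eq[OF this] have "tangent_deriv A p u ?f = b (snd d p) * u $ i" for u
      by (simp add: tangent_deriv_def d')
    with assms[OF f] b(2) show ?thesis by simp
  qed
  then show ?thesis by (simp add: vec_eq_iff)
qed

text \<open>This resolves the definite description of the bracket. The witness \<open>w\<close> is
  the coordinate formula DY(X) - DX(Y) in the selected chart; it represents the commutator because
  the second derivatives of \<open>f\<close> cancel by symmetry, and it is unique because global
  functions separate tangent vectors.\<close>

lemma tangent_deriv_lie_bracket:
  assumes X: "vector_field A X" and Y: "vector_field A Y" and f: "smooth_fun A f"
  shows "tangent_deriv A p (lie_bracket A X Y p) f =
    field_deriv A X (field_deriv A Y f) p - field_deriv A Y (field_deriv A X f) p"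
proof -
  define d where "d = chart_at A p"
  have d: "d \<in> A" "p \<in> fst d" using d_def chart_at by auto
  define S where "S = snd d ` fst d"
  have S: "open S" "snd d p \<in> S" using open_codomain d by (auto simp: S_def)
  \<comment> \<open>Near \<open>p\<close> a field must be read in the single chart \<open>d\<close>,
    since its raw values refer to a chart that changes from point to point.\<close>
  define loc where "loc = (\<lambda>X y. components A d (chart_inv d y) (X (chart_inv d y)))"
  have loc: "smooth_on S (loc X)" if "vector_field A X" for X
    using that d by (simp add: vector_field_def loc_def S_def)
  have loc_p: "loc X (snd d p) = X p" for X
    unfolding loc_def using d components_chart_at[of p, folded d_def] by simp
  have second: "field_deriv A X (field_deriv A Y f) p =
      frechet_derivative (\<lambda>y. frechet_derivative (f \<circ> chart_inv d) (at y) (Y p)) (at (snd d p)) (X p) +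
      frechet_derivative (f \<circ> chart_inv d) (at (snd d p)) (frechet_derivative (loc Y) (at (snd d p)) (X p))"
    if f: "smooth_fun A f" and X: "vector_field A X" and Y: "vector_field A Y" for X Y f
  proof -
    let ?F = "f \<circ> chart_inv d"
    have F: "smooth_on S ?F" using f d by (simp add: smooth_fun_def S_def)
    let ?H = "\<lambda>y. frechet_derivative ?F (at y) (loc Y y)"
    have "smooth_on S ?H"
      by (intro smooth_on_frechet_derivative_field S F loc Y)
    then have "(?H has_derivative frechet_derivative ?H (at (snd d p))) (at (snd d p))"
      by (rule smooth_on_has_derivative[OF _ S(2)])
    then have "((field_deriv A Y f \<circ> chart_inv d) has_derivative frechet_derivative ?H (at (snd d p))) (at (snd d p))"
      by (rule has_derivative_transform_within_open[OF _ S])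
        (use tangent_deriv_chart[OF f d(1)] d in \<open>auto simp: field_deriv_def S_def loc_def\<close>)
    from frechet_derivative_eq[OF this]
    have "field_deriv A X (field_deriv A Y f) p = frechet_derivative ?H (at (snd d p)) (X p)"
      by (simp add: field_deriv_def tangent_deriv_def flip: d_def)
    also have "\<dots> = frechet_derivative (\<lambda>y. frechet_derivative ?F (at y) (loc Y (snd d p))) (at (snd d p)) (X p) +
        frechet_derivative ?F (at (snd d p)) (frechet_derivative (loc Y) (at (snd d p)) (X p))"
      by (rule frechet_derivative_frechet_derivative_field[OF S F loc[OF Y]])
    finally show ?thesis unfolding loc_p .
  qed
  define w where "w = frechet_derivative (loc Y) (at (snd d p)) (X p) - frechet_derivative (loc X) (at (snd d p)) (Y p)"
  have w: "tangent_deriv A p w f =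
      field_deriv A X (field_deriv A Y f) p - field_deriv A Y (field_deriv A X f) p"
    if f: "smooth_fun A f" for f
  proof -
    have F: "smooth_on S (f \<circ> chart_inv d)" using f d by (simp add: smooth_fun_def S_def)
    interpret D: linear "frechet_derivative (f \<circ> chart_inv d) (at (snd d p))"
      using smooth_on_has_derivative[OF F S(2)] by (rule has_derivative_linear)
    have "Ck_on (Suc (Suc 0)) (f \<circ> chart_inv d) S"
      using F unfolding smooth_on_def by blast
    from second_derivative_symmetric[OF S this, of "Y p" "X p"]
    show ?thesis
      unfolding second[OF f X Y] second[OF f Y X] w_def tangent_deriv_def Let_def
      by (simp add: D.diff flip: d_def)
  qed
  have "lie_bracket A X Y p = w"
    unfolding lie_bracket_def
  proof (rule the_equality)
    fix u assume "\<forall>f. smooth_fun A f \<longrightarrow> tangent_deriv A p u f =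
      field_deriv A X (field_deriv A Y f) p - field_deriv A Y (field_deriv A X f) p"
    then show "u = w" by (intro smooth_fun_differential_separates[of p u w]) (simp add: w)
  qed (simp add: w)
  with w[OF f] show ?thesis by simp
qed

text \<open>Where \<psi> is nonzero, \<open>f\<close> is a quotient of smooth functions. The lemma
  serves quantities that a partial frame computes only up to the factor \<psi>.\<close>

lemma smooth_fun_local:
  assumes "\<And>p. \<exists>\<psi>. smooth_fun A \<psi> \<and> \<psi> p \<noteq> 0 \<and> smooth_fun A (\<lambda>q. \<psi> q * f q)"
  shows "smooth_fun A f"
  unfolding smooth_fun_def
proof (intro ballI smooth_on_local)
  fix c y assume c: "c \<in> A" and "y \<in> snd c ` fst c"
  then obtain p where p: "p \<in> fst c" "y = snd c p" by auto
  obtain \<psi> where \<psi>: "smooth_fun A \<psi>" "\<psi> p \<noteq> 0" "smooth_fun A (\<lambda>q. \<psi> q * f q)"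
    using assms by blast
  let ?S = "snd c ` fst c"
  let ?U = "{y \<in> ?S. (\<psi> \<circ> chart_inv c) y \<in> - {0}}"
  have s: "smooth_on ?S (\<psi> \<circ> chart_inv c)" "smooth_on ?S ((\<lambda>q. \<psi> q * f q) \<circ> chart_inv c)"
    using \<psi> c by (auto simp: smooth_fun_def)
  then have "continuous_on ?S (\<psi> \<circ> chart_inv c)"
    unfolding smooth_on_def by (metis Ck_on.simps(1))
  then have U: "open ?U"
    using continuous_open_preimage[OF _ open_codomain[OF c], of "\<psi> \<circ> chart_inv c" "- {0}"]
    by (simp only: vimage_def Int_def mem_Collect_eq open_Compl closed_singleton simp_thms)
  have "smooth_on ?U (\<lambda>y. ((\<lambda>q. \<psi> q * f q) \<circ> chart_inv c) y * inverse ((\<psi> \<circ> chart_inv c) y))"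
    by (intro smooth_on_mult smooth_on_inverse U smooth_on_subset[OF s(1)] smooth_on_subset[OF s(2)]) auto
  then have "smooth_on ?U (f \<circ> chart_inv c)"
    by (subst (asm) smooth_on_cong[OF U, of _ "f \<circ> chart_inv c"]) auto
  moreover have "y \<in> ?U" using p c \<psi> by simp
  ultimately show "\<exists>U. open U \<and> y \<in> U \<and> smooth_on U (f \<circ> chart_inv c)" using U by blast
qed

section \<open>From vector fields to tangent vectors\<close>

lemma vector_field_through:
  obtains X where "vector_field A X" "X p = v"
proof -
  obtain \<psi> :: "'m \<Rightarrow> real" and E :: "'n \<Rightarrow> 'm \<Rightarrow> real^'n" and \<theta> :: "'n \<Rightarrow> 'm \<Rightarrow> real^'n \<Rightarrow> real"
    where \<psi>: "\<psi> p \<noteq> 0" and E: "\<forall>i. vector_field A (E i)"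
      and frame: "\<forall>q v. (\<Sum>i\<in>UNIV. \<theta> i q v *\<^sub>R E i q) = \<psi> q *\<^sub>R v"
    using partial_frame[of p] by blast
  show ?thesis
  proof
    show "vector_field A (\<lambda>q. \<Sum>i\<in>UNIV. (\<theta> i p v / \<psi> p) *\<^sub>R E i q)"
      by (intro vector_field_sum vector_field_scaleR smooth_fun_const E[rule_format])
    have "(\<Sum>i\<in>UNIV. (\<theta> i p v / \<psi> p) *\<^sub>R E i p) = (1 / \<psi> p) *\<^sub>R (\<Sum>i\<in>UNIV. \<theta> i p v *\<^sub>R E i p)"
      by (simp add: scaleR_sum_right)
    then show "(\<Sum>i\<in>UNIV. (\<theta> i p v / \<psi> p) *\<^sub>R E i p) = v"
      using \<psi> by (simp add: frame)
  qed
qed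

text \<open>The field \<psi> X is a combination of the global fields \<open>E i\<close> with smooth
  coefficients \<open>\<theta> i\<close> (X). Linearity over smooth functions therefore expresses
  \<open>T X\<close> through the numbers \<open>\<theta> i p (X p)\<close>, after division by
  \<psi>(p).\<close>

lemma tensorial_linear:
  fixes T :: "('m \<Rightarrow> real^'n) \<Rightarrow> 'b::real_vector"
  assumes add: "\<And>X Y. vector_field A X \<Longrightarrow> vector_field A Y \<Longrightarrow> T (\<lambda>q. X q + Y q) = T X + T Y"
    and scale: "\<And>f X. smooth_fun A f \<Longrightarrow> vector_field A X \<Longrightarrow> T (\<lambda>q. f q *\<^sub>R X q) = f p *\<^sub>R T X"
  shows "\<exists>L. linear L \<and> (\<forall>X. vector_field A X \<longrightarrow> L (X p) = T X)"
proof -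
  obtain \<psi> :: "'m \<Rightarrow> real" and E :: "'n \<Rightarrow> 'm \<Rightarrow> real^'n" and \<theta> :: "'n \<Rightarrow> 'm \<Rightarrow> real^'n \<Rightarrow> real"
    where \<psi>: "smooth_fun A \<psi>" "\<psi> p \<noteq> 0" and E: "\<forall>i. vector_field A (E i)" and \<theta>: "\<forall>i. one_form A (\<theta> i)"
      and frame: "\<forall>q v. (\<Sum>i\<in>UNIV. \<theta> i q v *\<^sub>R E i q) = \<psi> q *\<^sub>R v"
    using partial_frame[of p] by blast
  have zero: "T (\<lambda>q. 0) = 0"
    using scale[OF smooth_fun_const vector_field_zero, of 0] by simp
  have T_sum: "T (\<lambda>q. \<Sum>i\<in>I. f i q *\<^sub>R E i q) = (\<Sum>i\<in>I. f i p *\<^sub>R T (E i))"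
    if "\<And>i. smooth_fun A (f i)" for f and I :: "'n set"
  proof (induction I rule: infinite_finite_induct)
    case (insert i I)
    then show ?case
      using that by (simp add: add scale E vector_field_scaleR vector_field_sum)
  qed (simp_all add: zero)
  define L where "L v = (1 / \<psi> p) *\<^sub>R (\<Sum>i\<in>UNIV. \<theta> i p v *\<^sub>R T (E i))" for v
  have lin: "linear (\<theta> i p)" for i using \<theta> by (simp add: one_form_def)
  have "linear L"
    by (intro linearI) (simp_all add: L_def linear_add[OF lin] linear_scale[OF lin] scaleR_add_left
        sum.distrib scaleR_add_right scaleR_sum_right mult.left_commute)
  moreover have "L (X p) = T X" if X: "vector_field A X" for X
  proof -
    have "\<psi> p *\<^sub>R T X = T (\<lambda>q. \<psi> q *\<^sub>R X q)" using scale[OF \<psi>(1) X] by simp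
    also have "\<dots> = T (\<lambda>q. \<Sum>i\<in>UNIV. \<theta> i q (X q) *\<^sub>R E i q)" by (simp add: frame)
    also have "\<dots> = (\<Sum>i\<in>UNIV. \<theta> i p (X p) *\<^sub>R T (E i))"
      using \<theta> X by (intro T_sum) (simp add: one_form_def)
    finally have *: "\<psi> p *\<^sub>R T X = (\<Sum>i\<in>UNIV. \<theta> i p (X p) *\<^sub>R T (E i))" .
    then show ?thesis using \<psi>(2) by (simp add: L_def flip: *)
  qed
  ultimately show ?thesis by blast
qed

section \<open>Rules for field derivatives and the Jacobi identity\<close>

lemma linear_tangent_deriv:
  assumes "smooth_fun A f"
  shows "linear (\<lambda>v. tangent_deriv A p v f)"
  unfolding tangent_deriv_def Let_def
  using has_derivative_linear[OF smooth_fun_has_derivative[OF assms chart_at]] .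

lemma field_deriv_const: "field_deriv A X (\<lambda>q. a) p = 0"
  by (simp add: field_deriv_def tangent_deriv_def o_def)

lemma field_deriv_add:
  assumes "smooth_fun A f" "smooth_fun A h"
  shows "field_deriv A X (\<lambda>q. f q + h q) p = field_deriv A X f p + field_deriv A X h p"
  unfolding field_deriv_def tangent_deriv_def Let_def
  using frechet_derivative_eq[OF has_derivative_add[OF smooth_fun_has_derivative[OF assms(1) chart_at]
        smooth_fun_has_derivative[OF assms(2) chart_at], of p]]
  by (simp add: o_def)

lemma field_deriv_diff:
  assumes "smooth_fun A f" "smooth_fun A h"
  shows "field_deriv A X (\<lambda>q. f q - h q) p = field_deriv A X f p - field_deriv A X h p"
  unfolding field_deriv_def tangent_deriv_def Let_def
  using frechet_derivative_eq[OF has_derivative_diff[OF smooth_fun_has_derivative[OF assms(1) chart_at]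
        smooth_fun_has_derivative[OF assms(2) chart_at], of p]]
  by (simp add: o_def)

lemma field_deriv_mult:
  assumes "smooth_fun A f" "smooth_fun A h"
  shows "field_deriv A X (\<lambda>q. f q * h q) p = f p * field_deriv A X h p + field_deriv A X f p * h p"
  unfolding field_deriv_def tangent_deriv_def Let_def
  using frechet_derivative_eq[OF has_derivative_mult[OF smooth_fun_has_derivative[OF assms(1) chart_at]
        smooth_fun_has_derivative[OF assms(2) chart_at], of p]]
  by (simp add: o_def chart_at)

lemma field_deriv_lie_bracket:
  "vector_field A X \<Longrightarrow> vector_field A Y \<Longrightarrow> smooth_fun A f \<Longrightarrow>
    field_deriv A (lie_bracket A X Y) f p =
      field_deriv A X (field_deriv A Y f) p - field_deriv A Y (field_deriv A X f) p"
  unfolding field_deriv_def[of A "lie_bracket A X Y"] by (rule tangent_deriv_lie_bracket)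

lemma vector_field_uminus: "vector_field A X \<Longrightarrow> vector_field A (\<lambda>q. - X q)"
  using vector_field_scaleR[OF smooth_fun_const, of X "- 1"] by simp

lemma vector_field_diff: "vector_field A X \<Longrightarrow> vector_field A Y \<Longrightarrow> vector_field A (\<lambda>q. X q - Y q)"
  using vector_field_add[OF _ vector_field_uminus] by fastforce

text \<open>As derivations, the nested brackets expand into twelve third-order terms that cancel in
  pairs. Smoothness of the brackets is a hypothesis here; for a Levi-Civita connection it is
  supplied by \<open>vf_lie_bracket\<close>, from the absence of torsion.\<close>

lemma jacobi_identity:
  assumes X: "vector_field A X" and Y: "vector_field A Y" and Z: "vector_field A Z"
    and YZ: "vector_field A (lie_bracket A Y Z)" and ZX: "vector_field A (lie_bracket A Z X)"
    and XY: "vector_field A (lie_bracket A X Y)"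
  shows "lie_bracket A X (lie_bracket A Y Z) p + lie_bracket A Y (lie_bracket A Z X) p +
    lie_bracket A Z (lie_bracket A X Y) p = 0"
proof (rule smooth_fun_differential_separates[of p])
  fix f assume f: "smooth_fun A f"
  note fd = smooth_fun_field_deriv
  have nested: "tangent_deriv A p (lie_bracket A X (lie_bracket A Y Z) p) f =
      field_deriv A X (field_deriv A Y (field_deriv A Z f)) p - field_deriv A X (field_deriv A Z (field_deriv A Y f)) p
      - (field_deriv A Y (field_deriv A Z (field_deriv A X f)) p - field_deriv A Z (field_deriv A Y (field_deriv A X f)) p)"
    if X: "vector_field A X" and Y: "vector_field A Y" and Z: "vector_field A Z"
      and YZ: "vector_field A (lie_bracket A Y Z)" for X Y Z
  proof -
    have e: "field_deriv A (lie_bracket A Y Z) f =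
        (\<lambda>q. field_deriv A Y (field_deriv A Z f) q - field_deriv A Z (field_deriv A Y f) q)"
      using field_deriv_lie_bracket[OF Y Z f] by (rule ext)
    show ?thesis
      unfolding tangent_deriv_lie_bracket[OF X YZ f] e field_deriv_lie_bracket[OF Y Z fd[OF f X]]
      by (simp add: field_deriv_diff fd f X Y Z)
  qed
  interpret D: linear "\<lambda>v. tangent_deriv A p v f" by (rule linear_tangent_deriv[OF f])
  show "tangent_deriv A p (lie_bracket A X (lie_bracket A Y Z) p + lie_bracket A Y (lie_bracket A Z X) p +
    lie_bracket A Z (lie_bracket A X Y) p) f = tangent_deriv A p 0 f"
    by (simp add: D.add D.zero nested[OF X Y Z YZ] nested[OF Y Z X ZX] nested[OF Z X Y XY])
qed

end

lemma trace_matrix_eq_sum: "trace (matrix F) = (\<Sum>i\<in>UNIV. F (axis i 1) $ i)"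
  by (simp add: trace_def matrix_def)

text \<open>Expand \<open>F (E i)\<close> in the standard basis and interchange the sums: the inner
  sum reassembles \<open>c\<close> times a basis vector. The factor \<open>c\<close> is \<psi>(p)
  for a partial frame and 1 for a true frame.\<close>

lemma trace_matrix_frame:
  fixes F :: "real^'n \<Rightarrow> real^'n"
  assumes F: "linear F" and \<theta>: "\<And>i. i \<in> I \<Longrightarrow> linear (\<theta> i)"
    and frame: "\<And>v. (\<Sum>i\<in>I. \<theta> i v *\<^sub>R E i) = c *\<^sub>R v"
  shows "(\<Sum>i\<in>I. \<theta> i (F (E i))) = c * trace (matrix F)"
proof -
  interpret F: linear F by fact
  have "\<theta> i (F (E i)) = (\<Sum>j\<in>UNIV. \<theta> i (axis j 1) * F (E i) $ j)" if "i \<in> I" for i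
  proof -
    interpret \<theta>: linear "\<theta> i" using \<theta> that .
    have "F (E i) = (\<Sum>j\<in>UNIV. F (E i) $ j *\<^sub>R axis j 1)"
      using basis_expansion[of "F (E i)"] by (simp add: scalar_mult_eq_scaleR)
    then have "\<theta> i (F (E i)) = \<theta> i (\<Sum>j\<in>UNIV. F (E i) $ j *\<^sub>R axis j 1)" by (rule arg_cong)
    also have "\<dots> = (\<Sum>j\<in>UNIV. F (E i) $ j *\<^sub>R \<theta> i (axis j 1))"
      unfolding \<theta>.sum \<theta>.scaleR ..
    finally show ?thesis by (simp add: mult.commute)
  qed
  then have "(\<Sum>i\<in>I. \<theta> i (F (E i))) = (\<Sum>i\<in>I. \<Sum>j\<in>UNIV. \<theta> i (axis j 1) * F (E i) $ j)" by simp
  also have "\<dots> = (\<Sum>j\<in>UNIV. \<Sum>i\<in>I. \<theta> i (axis j 1) * F (E i) $ j)" by (rule sum.swap)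
  also have "\<dots> = (\<Sum>j\<in>UNIV. F (\<Sum>i\<in>I. \<theta> i (axis j 1) *\<^sub>R E i) $ j)"
    by (simp add: F.sum F.scaleR)
  also have "\<dots> = (\<Sum>j\<in>UNIV. c * F (axis j 1) $ j)"
    by (simp add: frame F.scaleR)
  finally show ?thesis by (simp add: trace_matrix_eq_sum sum_distrib_left)
qed

section \<open>The Levi-Civita connection and its curvature\<close>

locale levi_civita_manifold = smooth_manifold A
  for A :: "('m::{t2_space, second_countable_topology}, 'n::finite) chart set" +
  fixes g :: "'m \<Rightarrow> real^'n \<Rightarrow> real^'n \<Rightarrow> real"
    and nabla :: "('m \<Rightarrow> real^'n) \<Rightarrow> ('m \<Rightarrow> real^'n) \<Rightarrow> 'm \<Rightarrow> real^'n"
  assumes metric: "pseudo_riemannian_metric A g"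
    and levi_civita: "levi_civita_connection A g nabla"
begin

abbreviation vf where "vf \<equiv> vector_field A"
abbreviation R where "R \<equiv> curvature A nabla"
abbreviation Ric where "Ric \<equiv> Ricci A nabla"

lemma bilinear_g: "bilinear (g p)"
  using metric unfolding pseudo_riemannian_metric_def by blast

lemmas g_simps = bilinear_ladd[OF bilinear_g] bilinear_radd[OF bilinear_g]
  bilinear_lmul[OF bilinear_g] bilinear_rmul[OF bilinear_g]
  bilinear_lsub[OF bilinear_g] bilinear_rsub[OF bilinear_g]
  bilinear_lneg[OF bilinear_g] bilinear_rneg[OF bilinear_g]
  bilinear_lzero[OF bilinear_g] bilinear_rzero[OF bilinear_g]

lemma g_commute: "g p u v = g p v u"
  using metric unfolding pseudo_riemannian_metric_def by blast

lemma g_nondegenerate: "(\<And>v. g p u v = 0) \<Longrightarrow> u = 0"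
  using metric unfolding pseudo_riemannian_metric_def by blast

lemma smooth_fun_g: "vf X \<Longrightarrow> vf Y \<Longrightarrow> smooth_fun A (\<lambda>q. g q (X q) (Y q))"
  using metric unfolding pseudo_riemannian_metric_def by blast

lemma connection: "affine_connection A nabla"
  using levi_civita unfolding levi_civita_connection_def by blast

lemma vf_nabla: "vf X \<Longrightarrow> vf Y \<Longrightarrow> vf (nabla X Y)"
  using connection unfolding affine_connection_def by blast

text \<open>This and the following laws equate whole fields and not just values at a point, because
  curvature applies \<open>nabla\<close> again to the result.\<close>

lemma nabla_add_left:
  "vf X \<Longrightarrow> vf X' \<Longrightarrow> vf Y \<Longrightarrow> nabla (\<lambda>q. X q + X' q) Y = (\<lambda>p. nabla X Y p + nabla X' Y p)"
  using connection unfolding affine_connection_def fun_eq_iff by blast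

lemma nabla_scaleR_left:
  "smooth_fun A f \<Longrightarrow> vf X \<Longrightarrow> vf Y \<Longrightarrow> nabla (\<lambda>q. f q *\<^sub>R X q) Y = (\<lambda>p. f p *\<^sub>R nabla X Y p)"
  using connection unfolding affine_connection_def fun_eq_iff by blast

lemma nabla_add_right:
  "vf X \<Longrightarrow> vf Y \<Longrightarrow> vf Y' \<Longrightarrow> nabla X (\<lambda>q. Y q + Y' q) = (\<lambda>p. nabla X Y p + nabla X Y' p)"
  using connection unfolding affine_connection_def fun_eq_iff by blast

lemma nabla_scaleR_right:
  "smooth_fun A f \<Longrightarrow> vf X \<Longrightarrow> vf Y \<Longrightarrow>
    nabla X (\<lambda>q. f q *\<^sub>R Y q) = (\<lambda>p. field_deriv A X f p *\<^sub>R Y p + f p *\<^sub>R nabla X Y p)"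
  using connection unfolding affine_connection_def fun_eq_iff by blast

text \<open>Absence of torsion, used as a rewrite rule: it replaces the definite description by
  \<open>nabla\<close> and makes the bracket of smooth fields smooth.\<close>

lemma lie_bracket_eq:
  "vf X \<Longrightarrow> vf Y \<Longrightarrow> lie_bracket A X Y = (\<lambda>p. nabla X Y p - nabla Y X p)"
  using levi_civita unfolding levi_civita_connection_def fun_eq_iff by metis

lemma field_deriv_g:
  "vf X \<Longrightarrow> vf Y \<Longrightarrow> vf Z \<Longrightarrow> field_deriv A X (\<lambda>q. g q (Y q) (Z q)) =
    (\<lambda>p. g p (nabla X Y p) (Z p) + g p (Y p) (nabla X Z p))"
  using levi_civita unfolding levi_civita_connection_def fun_eq_iff by blast

lemma nabla_diff_left:
  assumes "vf X" "vf X'" "vf Y"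
  shows "nabla (\<lambda>q. X q - X' q) Y = (\<lambda>p. nabla X Y p - nabla X' Y p)"
  using nabla_add_left[OF assms(1) vector_field_uminus[OF assms(2)] assms(3)]
    nabla_scaleR_left[OF smooth_fun_const assms(2,3), of "- 1"] by simp

lemma nabla_diff_right:
  assumes "vf X" "vf Y" "vf Y'"
  shows "nabla X (\<lambda>q. Y q - Y' q) = (\<lambda>p. nabla X Y p - nabla X Y' p)"
  using nabla_add_right[OF assms(1,2) vector_field_uminus[OF assms(3)]]
    nabla_scaleR_right[OF smooth_fun_const assms(1,3), of "- 1"] by (simp add: field_deriv_const)

lemma nabla_zero_right: "vf X \<Longrightarrow> nabla X (\<lambda>q. 0) = (\<lambda>p. 0)"
  using nabla_scaleR_right[OF smooth_fun_const _ vector_field_zero, of X 0] by (simp add: field_deriv_const)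

lemma vf_lie_bracket: "vf X \<Longrightarrow> vf Y \<Longrightarrow> vf (lie_bracket A X Y)"
  by (simp add: lie_bracket_eq vector_field_diff vf_nabla)

section \<open>Tensoriality and symmetries of the curvature\<close>

lemma R_eq: "R X Y Z = (\<lambda>p. nabla X (nabla Y Z) p - nabla Y (nabla X Z) p - nabla (lie_bracket A X Y) Z p)"
  by (rule ext) (rule curvature_def)

lemma vf_R: "vf X \<Longrightarrow> vf Y \<Longrightarrow> vf Z \<Longrightarrow> vf (R X Y Z)"
  unfolding R_eq by (intro vector_field_diff vf_nabla vf_lie_bracket)

lemma R_antisym:
  assumes "vf X" "vf Y" "vf Z"
  shows "R X Y Z p = - R Y X Z p"
  using assms by (simp add: R_eq lie_bracket_eq nabla_diff_left vf_nabla)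

lemma R_same: "vf X \<Longrightarrow> vf Z \<Longrightarrow> R X X Z p = 0"
  using R_antisym[of X X Z p] by (simp add: vec_eq_iff)

lemma R_add:
  assumes "vf X" "vf X'" "vf Y" "vf Z"
  shows "R (\<lambda>q. X q + X' q) Y Z p = R X Y Z p + R X' Y Z p"
proof -
  have "lie_bracket A (\<lambda>q. X q + X' q) Y = (\<lambda>q. lie_bracket A X Y q + lie_bracket A X' Y q)"
    using assms by (simp add: lie_bracket_eq vector_field_add nabla_add_left nabla_add_right fun_eq_iff)
  then show ?thesis
    using assms by (simp add: R_eq nabla_add_left nabla_add_right vf_nabla vf_lie_bracket)
qed

text \<open>Since [fX, Y] = f [X, Y] - (Yf) X, the bracket term of the curvature contributes (Yf)
  times \<open>nabla X Z\<close>, which cancels the derivative of f produced by differentiating f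
  \<open>nabla X Z\<close> along Y.\<close>

lemma R_scaleR:
  assumes f: "smooth_fun A f" and X: "vf X" and Y: "vf Y" and Z: "vf Z"
  shows "R (\<lambda>q. f q *\<^sub>R X q) Y Z p = f p *\<^sub>R R X Y Z p"
proof -
  have "lie_bracket A (\<lambda>q. f q *\<^sub>R X q) Y =
      (\<lambda>q. f q *\<^sub>R lie_bracket A X Y q - field_deriv A Y f q *\<^sub>R X q)"
    using assms by (simp add: lie_bracket_eq vector_field_scaleR nabla_scaleR_left nabla_scaleR_right
        fun_eq_iff algebra_simps)
  then show ?thesis
    using assms by (simp add: R_eq nabla_scaleR_left nabla_scaleR_right nabla_diff_left vf_nabla vf_lie_bracket
        vector_field_scaleR smooth_fun_field_deriv algebra_simps)
qed

text \<open>Apply the commutator of X and Y to the function g(Z, W). By metric compatibility the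
  mixed terms, with one derivative on each of Z and W, are symmetric in X and Y and cancel; the rest
  is the claim.\<close>

lemma R_skew:
  assumes X: "vf X" and Y: "vf Y" and Z: "vf Z" and W: "vf W"
  shows "g p (R X Y Z p) (W p) = - g p (R X Y W p) (Z p)"
proof -
  let ?h = "\<lambda>q. g q (Z q) (W q)"
  have second: "field_deriv A X (field_deriv A Y ?h) p =
      g p (nabla X (nabla Y Z) p) (W p) + g p (nabla Y Z p) (nabla X W p) +
      g p (nabla X Z p) (nabla Y W p) + g p (Z p) (nabla X (nabla Y W) p)"
    if "vf X" "vf Y" for X Y
    using that Z W by (simp add: field_deriv_g field_deriv_add smooth_fun_g vf_nabla)
  have "g p (nabla (lie_bracket A X Y) Z p) (W p) + g p (Z p) (nabla (lie_bracket A X Y) W p) =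
      field_deriv A (lie_bracket A X Y) ?h p"
    using assms by (simp add: field_deriv_g vf_lie_bracket)
  also have "\<dots> = field_deriv A X (field_deriv A Y ?h) p - field_deriv A Y (field_deriv A X ?h) p"
    by (intro field_deriv_lie_bracket X Y smooth_fun_g Z W)
  finally show ?thesis
    unfolding second[OF X Y] second[OF Y X]
    by (simp add: R_eq g_simps g_commute[of p _ "Z p"])
qed

text \<open>Without torsion, the cyclic sum of curvatures regroups into the cyclic sum of nested
  brackets, which the Jacobi identity annihilates.\<close>

lemma R_bianchi:
  assumes X: "vf X" and Y: "vf Y" and Z: "vf Z"
  shows "R X Y Z p + R Y Z X p + R Z X Y p = 0"
proof -
  have br: "lie_bracket A X (lie_bracket A Y Z) p =
      nabla X (nabla Y Z) p - nabla X (nabla Z Y) p - nabla (lie_bracket A Y Z) X p"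
    if "vf X" "vf Y" "vf Z" for X Y Z
    using that lie_bracket_eq[OF that(1) vf_lie_bracket[OF that(2,3)]]
    by (simp add: lie_bracket_eq[OF that(2,3)] nabla_diff_right vf_nabla)
  have "R X Y Z p + R Y Z X p + R Z X Y p = lie_bracket A X (lie_bracket A Y Z) p +
      lie_bracket A Y (lie_bracket A Z X) p + lie_bracket A Z (lie_bracket A X Y) p"
    unfolding br[OF X Y Z] br[OF Y Z X] br[OF Z X Y] by (simp add: R_eq)
  then show ?thesis
    using jacobi_identity[OF X Y Z] assms by (simp add: vf_lie_bracket)
qed

lemma eq_by_g:
  assumes "\<And>W. vf W \<Longrightarrow> g p u (W p) = g p v (W p)"
  shows "u = v"
proof -
  have "g p (u - v) w = 0" for w
    using vector_field_through[of p w] assms by (metis bilinear_lsub[OF bilinear_g] right_minus_eq)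
  then show ?thesis using g_nondegenerate by force
qed

lemma R_add3:
  assumes "vf X" "vf Y" "vf Z" "vf Z'"
  shows "R X Y (\<lambda>q. Z q + Z' q) p = R X Y Z p + R X Y Z' p"
  using assms by (simp add: R_eq nabla_add_right vf_nabla vf_lie_bracket)

text \<open>Skewness moves the scaled field out of the curvature into an argument of
  \<open>g\<close>, where scaling is pointwise. This bypasses second derivatives of
  \<open>f\<close>.\<close>

lemma R_scaleR3:
  assumes "smooth_fun A f" "vf X" "vf Y" "vf Z"
  shows "R X Y (\<lambda>q. f q *\<^sub>R Z q) p = f p *\<^sub>R R X Y Z p"
proof (rule eq_by_g)
  fix W assume "vf W"
  with assms show "g p (R X Y (\<lambda>q. f q *\<^sub>R Z q) p) (W p) = g p (f p *\<^sub>R R X Y Z p) (W p)"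
    by (simp add: R_skew[of _ _ _ W] vector_field_scaleR g_simps)
qed

section \<open>The Ricci tensor as a trace\<close>

lemma Ricci_endomorphism:
  assumes "vf Y" "vf Z"
  shows "\<exists>F. linear F \<and> (\<forall>X. vf X \<longrightarrow> F (X p) = R X Y Z p)"
  using assms by (intro tensorial_linear) (simp_all add: R_add R_scaleR)

text \<open>Any two candidates for the described endomorphism agree, because every tangent vector at
  \<open>p\<close> is the value of a global field.\<close>

lemma Ricci_eq_trace:
  assumes F: "linear F" "\<And>X. vf X \<Longrightarrow> F (X p) = R X Y Z p"
  shows "Ric Y Z p = trace (matrix F)"
proof -
  have "(THE F. linear F \<and> (\<forall>X. vf X \<longrightarrow> F (X p) = R X Y Z p)) = F"
  proof (rule the_equality)
    fix G assume G: "linear G \<and> (\<forall>X. vf X \<longrightarrow> G (X p) = R X Y Z p)"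
    show "G = F"
    proof
      fix v
      obtain X where "vf X" "X p = v" using vector_field_through .
      with F G show "G v = F v" by metis
    qed
  qed (use F in auto)
  then show ?thesis by (simp add: Ricci_def)
qed

lemma Ricci_trace_frame:
  assumes YZ: "vf Y" "vf Z" and E: "\<And>i. i \<in> I \<Longrightarrow> vf (E i)" and \<theta>: "\<And>i. i \<in> I \<Longrightarrow> linear (\<theta> i)"
    and frame: "\<And>v. (\<Sum>i\<in>I. \<theta> i v *\<^sub>R E i p) = c *\<^sub>R v"
  shows "(\<Sum>i\<in>I. \<theta> i (R (E i) Y Z p)) = c * Ric Y Z p"
proof -
  obtain F where F: "linear F" "\<forall>X. vf X \<longrightarrow> F (X p) = R X Y Z p"
    using Ricci_endomorphism[OF YZ] by blast
  have "(\<Sum>i\<in>I. \<theta> i (R (E i) Y Z p)) = (\<Sum>i\<in>I. \<theta> i (F (E i p)))"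
    using F(2) E by simp
  also have "\<dots> = c * trace (matrix F)"
    by (rule trace_matrix_frame[OF F(1) \<theta> frame])
  finally show ?thesis using F by (simp add: Ricci_eq_trace)
qed

lemma Ricci_sum_axis:
  assumes F: "linear F" "\<And>X. vf X \<Longrightarrow> F (X p) = R X Y Z p"
  shows "Ric Y Z p = (\<Sum>i\<in>UNIV. F (axis i 1) $ i)"
  using Ricci_eq_trace[OF F] by (simp add: trace_matrix_eq_sum)

text \<open>In a partial frame \<psi> Ric(Y, Z) is a finite sum of smooth functions, and
  \<open>smooth_fun_local\<close> removes \<psi>. Smoothness is what allows the sum and product
  rules for \<open>field_deriv\<close> to act on Ricci.\<close>

lemma smooth_Ricci:
  assumes Y: "vf Y" and Z: "vf Z"
  shows "smooth_fun A (Ric Y Z)"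
proof (rule smooth_fun_local)
  fix p
  obtain \<psi> :: "'m \<Rightarrow> real" and E :: "'n \<Rightarrow> 'm \<Rightarrow> real^'n" and \<theta> :: "'n \<Rightarrow> 'm \<Rightarrow> real^'n \<Rightarrow> real"
    where \<psi>: "smooth_fun A \<psi>" "\<psi> p \<noteq> 0" and E: "\<forall>i. vf (E i)" and \<theta>: "\<forall>i. one_form A (\<theta> i)"
      and frame: "\<forall>q v. (\<Sum>i\<in>UNIV. \<theta> i q v *\<^sub>R E i q) = \<psi> q *\<^sub>R v"
    using partial_frame[of p] by blast
  have "(\<lambda>q. \<psi> q * Ric Y Z q) = (\<lambda>q. \<Sum>i\<in>UNIV. \<theta> i q (R (E i) Y Z q))"
    using \<theta> by (intro ext Ricci_trace_frame[symmetric] Y Z E[rule_format] frame[rule_format])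
      (simp add: one_form_def)
  moreover have "smooth_fun A (\<lambda>q. \<Sum>i\<in>UNIV. \<theta> i q (R (E i) Y Z q))"
    using \<theta> E Y Z by (intro smooth_fun_sum) (simp add: one_form_def vf_R)
  ultimately show "\<exists>\<psi>. smooth_fun A \<psi> \<and> \<psi> p \<noteq> 0 \<and> smooth_fun A (\<lambda>q. \<psi> q * Ric Y Z q)"
    using \<psi> by auto
qed

lemma Ricci_add1:
  assumes "vf Y" "vf Y'" "vf Z"
  shows "Ric (\<lambda>q. Y q + Y' q) Z p = Ric Y Z p + Ric Y' Z p"
proof -
  obtain F where F: "linear F" "\<forall>X. vf X \<longrightarrow> F (X p) = R X Y Z p"
    using Ricci_endomorphism assms by blast
  obtain F' where F': "linear F'" "\<forall>X. vf X \<longrightarrow> F' (X p) = R X Y' Z p"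
    using Ricci_endomorphism assms by blast
  \<comment> \<open>Antisymmetry moves the sum into the first curvature argument, where additivity
    is known.\<close>
  have "R X (\<lambda>q. Y q + Y' q) Z p = R X Y Z p + R X Y' Z p" if "vf X" for X
    using that assms by (simp add: R_antisym[of X] vector_field_add R_add)
  then have "Ric (\<lambda>q. Y q + Y' q) Z p = (\<Sum>i\<in>UNIV. (F (axis i 1) + F' (axis i 1)) $ i)"
    using F F' by (intro Ricci_sum_axis linear_compose_add) auto
  then show ?thesis
    using F F' by (simp add: Ricci_sum_axis[of F] Ricci_sum_axis[of F'] sum.distrib)
qed

lemma Ricci_scaleR1:
  assumes "smooth_fun A f" "vf Y" "vf Z"
  shows "Ric (\<lambda>q. f q *\<^sub>R Y q) Z p = f p * Ric Y Z p"
proof -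
  obtain F where F: "linear F" "\<forall>X. vf X \<longrightarrow> F (X p) = R X Y Z p"
    using Ricci_endomorphism assms by blast
  have "R X (\<lambda>q. f q *\<^sub>R Y q) Z p = f p *\<^sub>R R X Y Z p" if "vf X" for X
    using that assms by (simp add: R_antisym[of X] vector_field_scaleR R_scaleR)
  then have "Ric (\<lambda>q. f q *\<^sub>R Y q) Z p = (\<Sum>i\<in>UNIV. (f p *\<^sub>R F (axis i 1)) $ i)"
    using F by (intro Ricci_sum_axis linear_compose_scale_right) auto
  then show ?thesis
    using F by (simp add: Ricci_sum_axis[of F] sum_distrib_left)
qed

lemma Ricci_add2:
  assumes "vf Y" "vf Z" "vf Z'"
  shows "Ric Y (\<lambda>q. Z q + Z' q) p = Ric Y Z p + Ric Y Z' p"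
proof -
  obtain F where F: "linear F" "\<forall>X. vf X \<longrightarrow> F (X p) = R X Y Z p"
    using Ricci_endomorphism assms by blast
  obtain F' where F': "linear F'" "\<forall>X. vf X \<longrightarrow> F' (X p) = R X Y Z' p"
    using Ricci_endomorphism assms by blast
  have "Ric Y (\<lambda>q. Z q + Z' q) p = (\<Sum>i\<in>UNIV. (F (axis i 1) + F' (axis i 1)) $ i)"
    using F F' assms by (intro Ricci_sum_axis linear_compose_add) (auto simp: R_add3)
  then show ?thesis
    using F F' by (simp add: Ricci_sum_axis[of F] Ricci_sum_axis[of F'] sum.distrib)
qed

lemma Ricci_scaleR2:
  assumes "smooth_fun A f" "vf Y" "vf Z"
  shows "Ric Y (\<lambda>q. f q *\<^sub>R Z q) p = f p * Ric Y Z p"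
proof -
  obtain F where F: "linear F" "\<forall>X. vf X \<longrightarrow> F (X p) = R X Y Z p"
    using Ricci_endomorphism assms by blast
  have "Ric Y (\<lambda>q. f q *\<^sub>R Z q) p = (\<Sum>i\<in>UNIV. (f p *\<^sub>R F (axis i 1)) $ i)"
    using F assms by (intro Ricci_sum_axis linear_compose_scale_right) (auto simp: R_scaleR3)
  then show ?thesis
    using F by (simp add: Ricci_sum_axis[of F] sum_distrib_left)
qed

text \<open>This reduces Ricci to bilinear algebra in one tangent space, so that it can be evaluated
  in a basis that is chosen at \<open>p\<close> only.\<close>

lemma Ricci_pointwise:
  "\<exists>r. bilinear r \<and> (\<forall>Y Z. vf Y \<longrightarrow> vf Z \<longrightarrow> Ric Y Z p = r (Y p) (Z p))"
proof -
  have "\<forall>v. \<exists>X. vf X \<and> X p = v" using vector_field_through by metis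
  then obtain ext where ext: "\<And>v. vf (ext v)" "\<And>v. ext v p = v" by metis
  have L1: "\<exists>L. linear L \<and> (\<forall>Y. vf Y \<longrightarrow> L (Y p) = Ric Y Z p)" if "vf Z" for Z
    using that by (intro tensorial_linear) (simp_all add: Ricci_add1 Ricci_scaleR1)
  have L2: "\<exists>L. linear L \<and> (\<forall>Z. vf Z \<longrightarrow> L (Z p) = Ric Y Z p)" if "vf Y" for Y
    using that by (intro tensorial_linear) (simp_all add: Ricci_add2 Ricci_scaleR2)
  \<comment> \<open>The extensions are arbitrary choices; \<open>L1\<close> and \<open>L2\<close>
    show, one slot at a time, that the value depends only on the vectors at
    \<open>p\<close>.\<close>
  define r where "r y z = Ric (ext y) (ext z) p" for y z
  have r: "Ric Y Z p = r (Y p) (Z p)" if "vf Y" "vf Z" for Y Z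
    unfolding r_def using L1[of Z] L2[of "ext (Y p)"] that ext by metis
  have "linear (\<lambda>y. r y z)" for z
  proof -
    obtain L where L: "linear L" "\<forall>Y. vf Y \<longrightarrow> L (Y p) = Ric Y (ext z) p" using L1 ext by blast
    have "(\<lambda>y. r y z) = L" using L ext unfolding r_def fun_eq_iff by metis
    then show ?thesis using L by simp
  qed
  moreover have "linear (r y)" for y
  proof -
    obtain L where L: "linear L" "\<forall>Z. vf Z \<longrightarrow> L (Z p) = Ric (ext y) Z p" using L2 ext by blast
    have "r y = L" using L ext unfolding r_def fun_eq_iff by metis
    then show ?thesis using L by simp
  qed
  ultimately show ?thesis using r unfolding bilinear_def by blast
qed

section \<open>Tensoriality of the covariant derivative of Ricci\<close>

abbreviation dRic where "dRic X \<equiv> nabla_0_2 A nabla X Ric"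

lemma dRic_add1:
  assumes "vf X" "vf Y" "vf Y'" "vf Z"
  shows "dRic X (\<lambda>q. Y q + Y' q) Z p = dRic X Y Z p + dRic X Y' Z p"
proof -
  have "Ric (\<lambda>q. Y q + Y' q) Z = (\<lambda>q. Ric Y Z q + Ric Y' Z q)"
    using assms by (intro ext Ricci_add1)
  then show ?thesis
    using assms by (simp add: nabla_0_2_def field_deriv_add smooth_Ricci nabla_add_right Ricci_add1 vf_nabla)
qed

lemma dRic_add2:
  assumes "vf X" "vf Y" "vf Z" "vf Z'"
  shows "dRic X Y (\<lambda>q. Z q + Z' q) p = dRic X Y Z p + dRic X Y Z' p"
proof -
  have "Ric Y (\<lambda>q. Z q + Z' q) = (\<lambda>q. Ric Y Z q + Ric Y Z' q)"
    using assms by (intro ext Ricci_add2)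
  then show ?thesis
    using assms by (simp add: nabla_0_2_def field_deriv_add smooth_Ricci nabla_add_right Ricci_add2 vf_nabla)
qed

text \<open>The term (Xf) Ric(Y, Z) from the product rule cancels against the same term from
  Ric(\<open>nabla X\<close> (fY), Z).\<close>

lemma dRic_scaleR1:
  assumes "smooth_fun A f" "vf X" "vf Y" "vf Z"
  shows "dRic X (\<lambda>q. f q *\<^sub>R Y q) Z p = f p * dRic X Y Z p"
proof -
  have "Ric (\<lambda>q. f q *\<^sub>R Y q) Z = (\<lambda>q. f q * Ric Y Z q)"
    using assms by (intro ext Ricci_scaleR1)
  then show ?thesis
    using assms by (simp add: nabla_0_2_def field_deriv_mult smooth_Ricci nabla_scaleR_right Ricci_add1
        Ricci_scaleR1 vf_nabla vector_field_scaleR smooth_fun_field_deriv algebra_simps)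
qed

lemma dRic_scaleR2:
  assumes "smooth_fun A f" "vf X" "vf Y" "vf Z"
  shows "dRic X Y (\<lambda>q. f q *\<^sub>R Z q) p = f p * dRic X Y Z p"
proof -
  have "Ric Y (\<lambda>q. f q *\<^sub>R Z q) = (\<lambda>q. f q * Ric Y Z q)"
    using assms by (intro ext Ricci_scaleR2)
  then show ?thesis
    using assms by (simp add: nabla_0_2_def field_deriv_mult smooth_Ricci nabla_scaleR_right Ricci_add2
        Ricci_scaleR2 vf_nabla vector_field_scaleR smooth_fun_field_deriv algebra_simps)
qed

end

section \<open>Three-dimensional quasi-para-Sasakian manifolds\<close>

lemma subspace_dim_1_span:
  fixes V :: "'a::euclidean_space set"
  assumes "subspace V" "dim V = 1"
  shows "\<exists>a. V = span {a} \<and> a \<noteq> 0"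
proof -
  obtain B where B: "B \<subseteq> V" "independent B" "V \<subseteq> span B" "card B = dim V"
    using basis_exists by blast
  then obtain a where "B = {a}" using assms(2) by (metis card_1_singletonE)
  moreover have "span B \<subseteq> V" using B(1) assms(1) by (rule span_minimal)
  ultimately show ?thesis using B by (metis dependent_single subset_antisym)
qed

locale para_sasakian_3_manifold = levi_civita_manifold A g nabla
  for A :: "('m::{t2_space, second_countable_topology}, 3) chart set"
    and g :: "'m \<Rightarrow> real^3 \<Rightarrow> real^3 \<Rightarrow> real"
    and nabla :: "('m \<Rightarrow> real^3) \<Rightarrow> ('m \<Rightarrow> real^3) \<Rightarrow> 'm \<Rightarrow> real^3" +
  fixes \<phi> :: "'m \<Rightarrow> real^3 \<Rightarrow> real^3"
    and \<eta> :: "'m \<Rightarrow> real^3 \<Rightarrow> real"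
    and \<xi> :: "'m \<Rightarrow> real^3"
  assumes quasi_para_sasakian: "quasi_para_sasakian_manifold A \<phi> \<eta> \<xi> g nabla"
begin

lemma almost_paracontact: "almost_paracontact_metric_manifold A \<phi> \<eta> \<xi> g"
  using quasi_para_sasakian unfolding quasi_para_sasakian_manifold_def by blast

lemma
  shows phi_tensor: "tensor_field_1_1 A \<phi>" and eta_form: "one_form A \<eta>" and vf_xi: "vf \<xi>"
    and phi_xi: "\<phi> p (\<xi> p) = 0" and eta_phi: "\<eta> p (\<phi> p v) = 0" and eta_xi: "\<eta> p (\<xi> p) = 1"
    and phi_phi: "\<phi> p (\<phi> p v) = v - \<eta> p v *\<^sub>R \<xi> p"
    and paracomplex: "paracomplex_structure_on {v. \<eta> p v = 0} (\<phi> p)"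
    and g_phi_phi: "g p (\<phi> p u) (\<phi> p v) = - g p u v + \<eta> p u * \<eta> p v"
  using almost_paracontact unfolding almost_paracontact_metric_manifold_def by blast+

lemma linear_phi: "linear (\<phi> p)" and vf_phi: "vf X \<Longrightarrow> vf (\<lambda>q. \<phi> q (X q))"
  using phi_tensor unfolding tensor_field_1_1_def by blast+

lemma linear_eta: "linear (\<eta> p)" and smooth_fun_eta: "vf X \<Longrightarrow> smooth_fun A (\<lambda>q. \<eta> q (X q))"
  using eta_form unfolding one_form_def by blast+

lemmas phi_simps = linear_add[OF linear_phi] linear_diff[OF linear_phi] linear_scale[OF linear_phi]
  linear_neg[OF linear_phi] linear_0[OF linear_phi]

lemmas eta_simps = linear_add[OF linear_eta] linear_diff[OF linear_eta] linear_scale[OF linear_eta]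
  linear_neg[OF linear_eta] linear_0[OF linear_eta]

section \<open>Derivatives and curvature of the field \<xi>\<close>

lemma g_xi: "g p v (\<xi> p) = \<eta> p v" "g p (\<xi> p) v = \<eta> p v"
  using g_phi_phi[of p v "\<xi> p"] g_commute[of p v] by (simp_all add: phi_xi eta_xi g_simps)

lemma g_phi: "g p (\<phi> p u) v = - g p u (\<phi> p v)"
  using g_phi_phi[of p u "\<phi> p v"] by (simp add: phi_phi eta_phi g_simps g_xi)

lemma nabla_phi:
  assumes "vf X" "vf Y"
  shows "nabla X (\<lambda>q. \<phi> q (Y q)) p = \<phi> p (nabla X Y p) + g p (X p) (Y p) *\<^sub>R \<xi> p - \<eta> p (Y p) *\<^sub>R X p"
proof -
  have "nabla_1_1 nabla X \<phi> Y p = g p (X p) (Y p) *\<^sub>R \<xi> p - \<eta> p (Y p) *\<^sub>R X p"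
    using quasi_para_sasakian assms unfolding quasi_para_sasakian_manifold_def by blast
  then show ?thesis by (simp add: nabla_1_1_def algebra_simps)
qed

text \<open>With \<xi> as the second field, the structure equation determines the \<phi>-image of
  the derivative, and hence the derivative up to a multiple of \<xi>. That multiple is 0 because
  g(\<xi>, \<xi>) = 1 is constant.\<close>

lemma nabla_xi:
  assumes X: "vf X"
  shows "nabla X \<xi> = (\<lambda>p. \<phi> p (X p))"
proof
  fix p
  have "\<phi> p (nabla X \<xi> p) = X p - \<eta> p (X p) *\<^sub>R \<xi> p"
    using nabla_phi[OF X vf_xi, of p] X by (simp add: phi_xi nabla_zero_right eta_xi g_xi algebra_simps)
  then have "\<phi> p (\<phi> p (nabla X \<xi> p)) = \<phi> p (X p)"
    by (simp add: phi_simps phi_xi)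
  moreover have "\<eta> p (nabla X \<xi> p) = 0"
    using field_deriv_g[OF X vf_xi vf_xi] by (simp add: g_xi eta_xi field_deriv_const fun_eq_iff)
  ultimately show "nabla X \<xi> p = \<phi> p (X p)" by (simp add: phi_phi)
qed

text \<open>After inserting \<phi> for the derivative of \<xi>, the images under \<phi> cancel by
  absence of torsion and the multiples of \<xi> by symmetry of \<open>g\<close>; only the two
  \<eta>-terms of the structure equation survive.\<close>

lemma R_xi:
  assumes "vf X" "vf Y"
  shows "R X Y \<xi> p = \<eta> p (X p) *\<^sub>R Y p - \<eta> p (Y p) *\<^sub>R X p"
proof -
  have "nabla (lie_bracket A X Y) \<xi> p = \<phi> p (nabla X Y p) - \<phi> p (nabla Y X p)"
    using assms by (simp add: nabla_xi vf_lie_bracket) (simp add: lie_bracket_eq phi_simps)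
  then show ?thesis
    using assms by (simp add: R_eq nabla_xi nabla_phi g_commute[of p "X p"])
qed

text \<open>The coefficient -2 is 1 - 3: the map v \<mapsto> \<eta>(v) Y has trace \<eta>(Y), and
  the identity of the tangent space has trace 3.\<close>

lemma Ricci_xi_right:
  assumes Y: "vf Y"
  shows "Ric Y \<xi> p = - 2 * \<eta> p (Y p)"
proof -
  have "Ric Y \<xi> p = (\<Sum>i\<in>UNIV. (\<eta> p (axis i 1) *\<^sub>R Y p - \<eta> p (Y p) *\<^sub>R axis i 1) $ i)"
    using Y by (intro Ricci_sum_axis linearI) (simp_all add: R_xi eta_simps algebra_simps)
  also have "\<dots> = (\<Sum>i\<in>UNIV. Y p $ i *\<^sub>R \<eta> p (axis i 1)) - 3 * \<eta> p (Y p)"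
    by (simp add: sum_subtractf mult.commute flip: sum_distrib_left)
  also have "(\<Sum>i\<in>UNIV. Y p $ i *\<^sub>R \<eta> p (axis i 1)) = \<eta> p (\<Sum>i\<in>UNIV. Y p $ i *\<^sub>R axis i 1)"
    by (simp add: linear_sum[OF linear_eta] eta_simps)
  also have "(\<Sum>i\<in>UNIV. Y p $ i *\<^sub>R axis i 1) = Y p"
    using basis_expansion[of "Y p"] by (simp add: scalar_mult_eq_scaleR)
  finally show ?thesis by simp
qed

text \<open>The expansion says that g(-, b), g(-, a) and \<eta> form the coframe dual to a, b,
  \<xi>, which is the form that traces require. It also contains the normalization g(a, b) = 1, as v
  = a shows.\<close>

definition isotropic_frame :: "'m \<Rightarrow> real^3 \<Rightarrow> real^3 \<Rightarrow> bool" where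
  "isotropic_frame p a b \<longleftrightarrow> g p a a = 0 \<and> g p b b = 0 \<and> \<eta> p a = 0 \<and> \<eta> p b = 0 \<and>
    (\<forall>v. v = g p v b *\<^sub>R a + g p v a *\<^sub>R b + \<eta> p v *\<^sub>R \<xi> p)"

lemma isotropic_frame_swap: "isotropic_frame p a b \<Longrightarrow> isotropic_frame p b a"
  unfolding isotropic_frame_def by (metis add.commute)

text \<open>\<open>U\<close> and \<open>V\<close> need to be isotropic at \<open>p\<close> only; any
  extensions of a and b will do.\<close>

lemma Ricci_isotropic_frame:
  assumes frame: "isotropic_frame p (U p) (V p)" and U: "vf U" and V: "vf V" and Y: "vf Y" and Z: "vf Z"
  shows "Ric Y Z p = g p (R U Y Z p) (V p) + g p (R V Y Z p) (U p) + \<eta> p (R \<xi> Y Z p)"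
proof -
  define E where "E = (\<lambda>i::3. if i = 1 then U else if i = 2 then V else \<xi>)"
  define \<theta> where "\<theta> = (\<lambda>i::3. if i = 1 then (\<lambda>v. g p v (V p)) else if i = 2 then (\<lambda>v. g p v (U p)) else \<eta> p)"
  have "(\<Sum>i\<in>UNIV. \<theta> i (R (E i) Y Z p)) = 1 * Ric Y Z p"
  proof (rule Ricci_trace_frame[OF Y Z])
    show "vf (E i)" for i using U V vf_xi by (simp add: E_def)
    show "linear (\<theta> i)" for i using linear_eta bilinear_g unfolding \<theta>_def bilinear_def by simp
    show "(\<Sum>i\<in>UNIV. \<theta> i v *\<^sub>R E i p) = 1 *\<^sub>R v" for v
      using frame unfolding isotropic_frame_def by (simp add: sum_3 \<theta>_def E_def)
  qed
  then show ?thesis by (simp add: sum_3 \<theta>_def E_def)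
qed

text \<open>Dimension 3 leaves three terms in the trace. The one along U has a repeated argument,
  the one along V vanishes by skewness, and the one along \<xi> becomes -g(U, U) = 0 after skewness
  brings in R(\<xi>, U)\<xi> = U.\<close>

lemma Ricci_isotropic_diagonal:
  assumes frame: "isotropic_frame p (U p) (V p)" and U: "vf U" and V: "vf V"
  shows "Ric U U p = 0"
proof -
  have "g p (R V U U p) (U p) = 0"
    using R_skew[OF V U U U, of p] by simp
  moreover have "\<eta> p (R \<xi> U U p) = 0"
    using R_skew[OF vf_xi U U vf_xi, of p] frame
    by (simp add: R_xi vf_xi U eta_xi g_xi isotropic_frame_def)
  ultimately show ?thesis
    by (simp add: Ricci_isotropic_frame[OF frame U V U U] R_same U g_simps)
qed

text \<open>The only term of the trace that does not vanish at once is g(R(U, \<xi>)U, V). Skewness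
  exchanges U and V there, and the Bianchi identity with R(V, U)\<xi> = 0 turns it into g(R(\<xi>,
  V)U, U), which is zero by skewness.\<close>

lemma Ricci_isotropic_xi:
  assumes frame: "isotropic_frame p (U p) (V p)" and U: "vf U" and V: "vf V"
  shows "Ric \<xi> U p = 0"
proof -
  have "R V U \<xi> p = 0"
    using frame by (simp add: R_xi U V isotropic_frame_def)
  then have "R U \<xi> V p = - R \<xi> V U p"
    using R_bianchi[OF U vf_xi V, of p] by (simp add: eq_neg_iff_add_eq_0)
  then have "g p (R U \<xi> U p) (V p) = g p (R \<xi> V U p) (U p)"
    using R_skew[OF U vf_xi U V, of p] by (simp add: g_simps)
  moreover have "g p (R W W' U p) (U p) = 0" if "vf W" "vf W'" for W W'
    using R_skew[OF that U U, of p] by simp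
  ultimately show ?thesis
    by (simp add: Ricci_isotropic_frame[OF frame U V vf_xi U] R_same vf_xi U V eta_simps)
qed

text \<open>The vectors a and b are taken from the eigenlines of \<phi> in the kernel of \<eta>;
  equality of the eigenspace dimensions is the part of the paracomplex structure that makes both of
  them lines.\<close>

lemma isotropic_frame_exists:
  obtains a b where "isotropic_frame p a b" "\<phi> p a = a" "\<phi> p b = - b"
proof -
  define D where "D s = {v. \<eta> p v = 0 \<and> \<phi> p v = s *\<^sub>R v}" for s :: real
  have sub: "subspace (D s)" for s
    by (simp add: subspace_def D_def eta_simps phi_simps algebra_simps)
  have D: "D 1 = {v \<in> {v. \<eta> p v = 0}. \<phi> p v = v}" "D (- 1) = {v \<in> {v. \<eta> p v = 0}. \<phi> p v = - v}"
    by (auto simp: D_def)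
  have dims: "dim (D 1) = dim (D (- 1))"
    using paracomplex[of p] unfolding paracomplex_structure_on_def D by blast
  have split: "v = (1/2) *\<^sub>R (\<phi> p (\<phi> p v) + \<phi> p v) + (1/2) *\<^sub>R (\<phi> p (\<phi> p v) - \<phi> p v) + \<eta> p v *\<^sub>R \<xi> p" for v
  proof -
    have "(1/2) *\<^sub>R (\<phi> p (\<phi> p v) + \<phi> p v) + (1/2) *\<^sub>R (\<phi> p (\<phi> p v) - \<phi> p v) = \<phi> p (\<phi> p v)"
      by (simp add: algebra_simps flip: scaleR_add_left)
    then show ?thesis by (simp add: phi_phi)
  qed
  have inD: "(1/2) *\<^sub>R (\<phi> p (\<phi> p v) + \<phi> p v) \<in> D 1" "(1/2) *\<^sub>R (\<phi> p (\<phi> p v) - \<phi> p v) \<in> D (- 1)" for v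
    by (simp_all add: D_def eta_simps phi_simps eta_phi phi_phi[of p "\<phi> p v"] algebra_simps)
  have D0: "D 1 \<inter> D (- 1) = {0}"
    by (auto simp: D_def eta_simps phi_simps vec_eq_iff)
  \<comment> \<open>This direct sum is the kernel of \<eta>. Together with \<xi> it spans the
    tangent space, so 3 = 2 dim (D 1) + 1.\<close>
  let ?S = "{x + y |x y. x \<in> D 1 \<and> y \<in> D (- 1)}"
  have subS: "subspace ?S" by (rule subspace_sums[OF sub sub])
  have "dim ?S + dim (D 1 \<inter> D (- 1)) = dim (D 1) + dim (D (- 1))"
    by (rule dim_sums_Int[OF sub sub])
  then have dimS: "dim ?S = 2 * dim (D 1)" using dims D0 by simp
  have "\<eta> p v = 0" if "v \<in> ?S" for v using that by (auto simp: D_def eta_simps)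
  then have xiS: "\<xi> p \<notin> ?S" using eta_xi[of p] by force
  have "(UNIV :: (real^3) set) = span (insert (\<xi> p) ?S)"
  proof (intro set_eqI iffI)
    fix v :: "real^3"
    have "(1/2) *\<^sub>R (\<phi> p (\<phi> p v) + \<phi> p v) + (1/2) *\<^sub>R (\<phi> p (\<phi> p v) - \<phi> p v) \<in> ?S"
      using inD[of v] by blast
    then have "(1/2) *\<^sub>R (\<phi> p (\<phi> p v) + \<phi> p v) + (1/2) *\<^sub>R (\<phi> p (\<phi> p v) - \<phi> p v) + \<eta> p v *\<^sub>R \<xi> p
        \<in> span (insert (\<xi> p) ?S)"
      by (intro span_add span_scale span_base) auto
    then show "v \<in> span (insert (\<xi> p) ?S)" by (simp flip: split)
  qed simp
  then have "dim (insert (\<xi> p) ?S) = 3"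
    using dim_span[of "insert (\<xi> p) ?S"] by simp
  moreover have "dim (insert (\<xi> p) ?S) = dim ?S + 1"
    using xiS subS by (simp add: dim_insert span_eq_iff[THEN iffD2])
  ultimately have "dim (D 1) = 1" using dimS by simp
  then obtain a b0 where ab: "D 1 = span {a}" "D (- 1) = span {b0}" "a \<noteq> 0" "b0 \<noteq> 0"
    using subspace_dim_1_span[OF sub] dims by metis
  \<comment> \<open>On an eigenspace the compatibility of \<open>g\<close> with \<phi> reads s^2
    g(u, v) = -g(u, v), and s^2 = 1.\<close>
  have iso: "g p u v = 0" if "u \<in> D s" "v \<in> D s" "s * s = 1" for u v s
  proof -
    have "s * s * g p u v = - g p u v"
      using that(1,2) g_phi_phi[of p u v] by (simp add: D_def g_simps)
    then show ?thesis unfolding that(3) by simp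
  qed
  have \<eta>: "\<eta> p v = 0" and \<phi>: "\<phi> p v = s *\<^sub>R v" if "v \<in> D s" for v s
    using that by (auto simp: D_def)
  have aD: "a \<in> D 1" and bD: "b0 \<in> D (- 1)" using ab span_base by blast+
  have coords: "\<exists>x y. v = x *\<^sub>R a + y *\<^sub>R b0 + \<eta> p v *\<^sub>R \<xi> p" for v
  proof -
    obtain x y where "(1/2) *\<^sub>R (\<phi> p (\<phi> p v) + \<phi> p v) = x *\<^sub>R a"
      "(1/2) *\<^sub>R (\<phi> p (\<phi> p v) - \<phi> p v) = y *\<^sub>R b0"
      using inD[of v] unfolding ab span_singleton by blast
    with split[of v] show ?thesis by metis
  qed
  \<comment> \<open>As a is orthogonal to itself and to \<xi>, nondegeneracy forces g(a, b0) to be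
    nonzero; dividing b0 by it achieves g(a, b) = 1.\<close>
  define c where "c = g p a b0"
  have "c \<noteq> 0"
  proof
    assume c: "c = 0"
    have "g p a v = 0" for v
    proof -
      obtain x y where "v = x *\<^sub>R a + y *\<^sub>R b0 + \<eta> p v *\<^sub>R \<xi> p" using coords by blast
      then have "g p a v = g p a (x *\<^sub>R a + y *\<^sub>R b0 + \<eta> p v *\<^sub>R \<xi> p)" by (rule arg_cong)
      then show ?thesis using iso[OF aD aD] c \<eta>[OF aD] by (simp add: g_simps g_xi c_def)
    qed
    then show False using g_nondegenerate ab by blast
  qed
  define b where "b = (1 / c) *\<^sub>R b0"
  have bD': "b \<in> D (- 1)" using bD sub by (simp add: b_def subspace_scale)
  have g_frame: "g p a a = 0" "g p b0 b = 0" "g p a b = 1" "g p b0 a = c"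
    using iso[OF aD aD] iso[OF bD bD'] \<open>c \<noteq> 0\<close>
    by (simp_all add: b_def g_simps g_commute[of p b0 a] flip: c_def)
  have "v = g p v b *\<^sub>R a + g p v a *\<^sub>R b + \<eta> p v *\<^sub>R \<xi> p" for v
  proof -
    obtain x y where v: "v = x *\<^sub>R a + y *\<^sub>R b0 + \<eta> p v *\<^sub>R \<xi> p" using coords by blast
    \<comment> \<open>The expansion mentions v again inside \<eta>, so rewriting with it would loop;
      it is applied once, by congruence.\<close>
    have "g p v b = g p (x *\<^sub>R a + y *\<^sub>R b0 + \<eta> p v *\<^sub>R \<xi> p) b"
      by (rule arg_cong[where f = "\<lambda>v. g p v b", OF v])
    also have "\<dots> = x" by (simp add: g_simps g_xi g_frame \<eta>[OF bD'])
    finally have vb: "g p v b = x" .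
    have "g p v a = g p (x *\<^sub>R a + y *\<^sub>R b0 + \<eta> p v *\<^sub>R \<xi> p) a"
      by (rule arg_cong[where f = "\<lambda>v. g p v a", OF v])
    also have "\<dots> = y * c" by (simp add: g_simps g_xi g_frame \<eta>[OF aD])
    finally have va: "g p v a = y * c" .
    have "g p v b *\<^sub>R a + g p v a *\<^sub>R b + \<eta> p v *\<^sub>R \<xi> p = x *\<^sub>R a + y *\<^sub>R b0 + \<eta> p v *\<^sub>R \<xi> p"
      unfolding va vb using \<open>c \<noteq> 0\<close> by (simp add: b_def)
    from trans[OF v this[symmetric]] show ?thesis .
  qed
  then have "isotropic_frame p a b"
    using iso[OF aD aD] iso[OF bD' bD'] \<eta>[OF aD] \<eta>[OF bD'] by (simp add: isotropic_frame_def)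
  then show ?thesis
    using that \<phi>[OF aD] \<phi>[OF bD'] by simp
qed

text \<open>The counterpart of \<open>Ricci_xi_right\<close> in the other slot is obtained from the
  frame: the value is 0 on a and b and -2 on \<xi>.\<close>

lemma Ricci_xi_left:
  assumes Z: "vf Z"
  shows "Ric \<xi> Z p = - 2 * \<eta> p (Z p)"
proof -
  obtain a b where frame: "isotropic_frame p a b" using isotropic_frame_exists .
  obtain U where U: "vf U" "U p = a" using vector_field_through .
  obtain V where V: "vf V" "V p = b" using vector_field_through .
  obtain r where r: "bilinear r" "\<forall>Y Z. vf Y \<longrightarrow> vf Z \<longrightarrow> Ric Y Z p = r (Y p) (Z p)"
    using Ricci_pointwise by blast
  have "r (\<xi> p) a = 0" "r (\<xi> p) b = 0"
    using Ricci_isotropic_xi[of p U V] Ricci_isotropic_xi[of p V U] frame isotropic_frame_swap[OF frame]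
      U V vf_xi r(2) by auto
  moreover have "r (\<xi> p) (\<xi> p) = - 2"
    using Ricci_xi_right[OF vf_xi, of p] r(2) vf_xi by (simp add: eta_xi)
  moreover have "Z p = g p (Z p) b *\<^sub>R a + g p (Z p) a *\<^sub>R b + \<eta> p (Z p) *\<^sub>R \<xi> p"
    using frame unfolding isotropic_frame_def by blast
  then have "r (\<xi> p) (Z p) = r (\<xi> p) (g p (Z p) b *\<^sub>R a + g p (Z p) a *\<^sub>R b + \<eta> p (Z p) *\<^sub>R \<xi> p)"
    by (rule arg_cong)
  ultimately show ?thesis
    using r Z vf_xi by (simp add: bilinear_radd[OF r(1)] bilinear_rmul[OF r(1)])
qed

text \<open>In the basis a, b, \<xi> the map \<phi> is diagonal with eigenvalues 1, -1, 0, so each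
  component of Ricci is multiplied by the sum of two eigenvalues. That sum vanishes for the pairs
  (a, b), (b, a) and (\<xi>, \<xi>); on all other pairs Ricci itself vanishes.\<close>

lemma Ricci_phi:
  assumes X: "vf X" and Y: "vf Y"
  shows "Ric Y (\<lambda>q. \<phi> q (X q)) p + Ric (\<lambda>q. \<phi> q (Y q)) X p = 0"
proof -
  obtain a b where frame: "isotropic_frame p a b" and \<phi>: "\<phi> p a = a" "\<phi> p b = - b"
    using isotropic_frame_exists .
  obtain U where U: "vf U" "U p = a" using vector_field_through .
  obtain V where V: "vf V" "V p = b" using vector_field_through .
  obtain r where r: "bilinear r" "\<forall>Y Z. vf Y \<longrightarrow> vf Z \<longrightarrow> Ric Y Z p = r (Y p) (Z p)"
    using Ricci_pointwise by blast
  have diag: "r a a = 0" "r b b = 0"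
    using Ricci_isotropic_diagonal[of p U V] Ricci_isotropic_diagonal[of p V U] frame
      isotropic_frame_swap[OF frame] U V r(2) by auto
  have xi: "r (\<xi> p) (Z p) = - 2 * \<eta> p (Z p)" "r (Z p) (\<xi> p) = - 2 * \<eta> p (Z p)" if "vf Z" for Z
    using Ricci_xi_left[OF that, of p] Ricci_xi_right[OF that, of p] that r(2) vf_xi by simp_all
  have xi0: "r (\<xi> p) a = 0" "r (\<xi> p) b = 0" "r a (\<xi> p) = 0" "r b (\<xi> p) = 0"
    using xi[OF U(1)] xi[OF V(1)] U V frame by (auto simp: isotropic_frame_def)
  have exp: "v = g p v b *\<^sub>R a + g p v a *\<^sub>R b + \<eta> p v *\<^sub>R \<xi> p" for v
    using frame unfolding isotropic_frame_def by blast
  obtain x1 x2 x3 where x: "X p = x1 *\<^sub>R a + x2 *\<^sub>R b + x3 *\<^sub>R \<xi> p" using exp by blast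
  obtain y1 y2 y3 where y: "Y p = y1 *\<^sub>R a + y2 *\<^sub>R b + y3 *\<^sub>R \<xi> p" using exp by blast
  show ?thesis
    using r(2) X Y vf_phi
    by (simp add: x y phi_simps \<phi> phi_xi bilinear_ladd[OF r(1)] bilinear_radd[OF r(1)] bilinear_lmul[OF r(1)]
        bilinear_rmul[OF r(1)] bilinear_lneg[OF r(1)] bilinear_rneg[OF r(1)] diag xi0 bilinear_lsub[OF r(1)] bilinear_rsub[OF r(1)]
        algebra_simps)
qed

text \<open>Differentiate Ric(Y, \<xi>) = -2 \<eta>(Y) and its mirror image, writing \<eta>(Y) as
  g(Y, \<xi>). The part with \<open>nabla X Y\<close> cancels against the correction term in that
  slot, and the derivative \<phi> X of \<xi> supplies the rest.\<close>

lemma dRic_xi: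
  assumes X: "vf X" and Y: "vf Y"
  shows "dRic X Y \<xi> p = - 2 * g p (Y p) (\<phi> p (X p)) - Ric Y (\<lambda>q. \<phi> q (X q)) p"
    and "dRic X \<xi> Y p = - 2 * g p (Y p) (\<phi> p (X p)) - Ric (\<lambda>q. \<phi> q (X q)) Y p"
proof -
  have "field_deriv A X (\<lambda>q. \<eta> q (Y q)) p = \<eta> p (nabla X Y p) + g p (Y p) (\<phi> p (X p))"
    using field_deriv_g[OF X Y vf_xi] X by (simp add: g_xi nabla_xi)
  moreover have "field_deriv A X (\<lambda>q. - 2 * \<eta> q (Y q)) p = - 2 * field_deriv A X (\<lambda>q. \<eta> q (Y q)) p"
    using field_deriv_mult[OF smooth_fun_const smooth_fun_eta[OF Y], of X "- 2" p] by (simp add: field_deriv_const)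
  ultimately have fd: "field_deriv A X (\<lambda>q. - 2 * \<eta> q (Y q)) p =
      - 2 * \<eta> p (nabla X Y p) - 2 * g p (Y p) (\<phi> p (X p))" by simp
  have "Ric Y \<xi> = (\<lambda>q. - 2 * \<eta> q (Y q))" "Ric \<xi> Y = (\<lambda>q. - 2 * \<eta> q (Y q))"
    using Ricci_xi_left[OF Y] Ricci_xi_right[OF Y] by blast+
  then show "dRic X Y \<xi> p = - 2 * g p (Y p) (\<phi> p (X p)) - Ric Y (\<lambda>q. \<phi> q (X q)) p"
    and "dRic X \<xi> Y p = - 2 * g p (Y p) (\<phi> p (X p)) - Ric (\<lambda>q. \<phi> q (X q)) Y p"
    using fd X Y by (simp_all add: nabla_0_2_def nabla_xi Ricci_xi_right Ricci_xi_left vf_nabla)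
qed

lemma dRic_xi_xi:
  assumes X: "vf X"
  shows "dRic X \<xi> \<xi> p = 0"
  using X by (simp add: dRic_xi(1) vf_xi g_xi eta_phi Ricci_xi_left vf_phi)

text \<open>Split Y and Z into horizontal and \<xi>-parts. The hypothesis removes the horizontal
  pair and \<open>dRic_xi_xi\<close> the pair of \<xi>-parts, so in each mixed term the remaining
  horizontal part may be replaced by the full field.\<close>

lemma dRic_eta_parallel:
  assumes "eta_parallel_Ricci A \<phi> nabla" and X: "vf X" and Y: "vf Y" and Z: "vf Z"
  shows "dRic X Y Z p = \<eta> p (Z p) * dRic X Y \<xi> p + \<eta> p (Y p) * dRic X \<xi> Z p"
proof -
  define H where "H = (\<lambda>W q. \<phi> q (\<phi> q (W q)))"
  have H: "vf (H W)" if "vf W" for W using that by (simp add: H_def vf_phi)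
  have xi: "vf (\<lambda>q. \<eta> q (W q) *\<^sub>R \<xi> q)" if "vf W" for W
    using that by (intro vector_field_scaleR smooth_fun_eta vf_xi)
  have W: "W = (\<lambda>q. H W q + \<eta> q (W q) *\<^sub>R \<xi> q)" for W
    by (simp add: H_def phi_phi)
  have 2: "dRic X Y Z p = dRic X Y (H Z) p + \<eta> p (Z p) * dRic X Y \<xi> p" if "vf Y" for Y
    by (subst W[of Z]) (use that X Z H xi vf_xi in \<open>simp add: dRic_add2 dRic_scaleR2 smooth_fun_eta\<close>)
  have 1: "dRic X Y Z p = dRic X (H Y) Z p + \<eta> p (Y p) * dRic X \<xi> Z p" if "vf Z" for Z
    by (subst W[of Y]) (use that X Y H xi vf_xi in \<open>simp add: dRic_add1 dRic_scaleR1 smooth_fun_eta\<close>)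
  \<comment> \<open>The horizontal part is \<phi> applied twice, so the hypothesis is used with the
    fields \<phi> Y and \<phi> Z.\<close>
  have "dRic X (H Y) (H Z) p = 0"
    using assms vf_phi unfolding eta_parallel_Ricci_def H_def by blast
  then show ?thesis
    using 1[OF H[OF Z]] 2[OF Y] 2[OF vf_xi] dRic_xi_xi[OF X, of p] by simp
qed

end

theorem theorem6p8:
  fixes A :: "('m::{t2_space, second_countable_topology}, 3) chart set"
    and \<phi> :: "'m \<Rightarrow> real^3 \<Rightarrow> real^3"
    and \<eta> :: "'m \<Rightarrow> real^3 \<Rightarrow> real"
    and \<xi> :: "'m \<Rightarrow> real^3"
    and g :: "'m \<Rightarrow> real^3 \<Rightarrow> real^3 \<Rightarrow> real"
    and nabla :: "('m \<Rightarrow> real^3) \<Rightarrow> ('m \<Rightarrow> real^3) \<Rightarrow> 'm \<Rightarrow> real^3"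
  assumes "quasi_para_sasakian_manifold A \<phi> \<eta> \<xi> g nabla"
    and "eta_parallel_Ricci A \<phi> nabla"
  shows "\<forall>X Y Z p. vector_field A X \<longrightarrow> vector_field A Y \<longrightarrow> vector_field A Z \<longrightarrow>
           nabla_0_2 A nabla X (Ricci A nabla) Y Z p +
           nabla_0_2 A nabla Y (Ricci A nabla) Z X p +
           nabla_0_2 A nabla Z (Ricci A nabla) X Y p = 0"
proof (intro allI impI)
  fix X Y Z p assume vf: "vector_field A X" "vector_field A Y" "vector_field A Z"
  interpret para_sasakian_3_manifold A g nabla \<phi> \<eta> \<xi>
    using assms(1) unfolding quasi_para_sasakian_manifold_def almost_paracontact_metric_manifold_def
    by unfold_locales (auto simp: quasi_para_sasakian_manifold_def almost_paracontact_metric_manifold_def)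
  \<comment> \<open>The two summands put \<xi> into different slots, so \<open>dRic_xi\<close>
    produces Ric(Y, \<phi> X) and Ric(\<phi> Y, X), exactly the pair in
    \<open>Ricci_phi\<close>.\<close>
  have sym: "dRic X Y \<xi> p + dRic Y \<xi> X p = 0" if "vector_field A X" "vector_field A Y" for X Y
    using Ricci_phi[OF that, of p] g_phi[of p "Y p" "X p"] g_commute[of p "X p"]
    by (simp add: dRic_xi that)
  show "dRic X Y Z p + dRic Y Z X p + dRic Z X Y p = 0"
  proof -
    have "dRic X Y Z p + dRic Y Z X p + dRic Z X Y p =
        \<eta> p (Z p) * (dRic X Y \<xi> p + dRic Y \<xi> X p) + \<eta> p (X p) * (dRic Y Z \<xi> p + dRic Z \<xi> Y p) +
        \<eta> p (Y p) * (dRic Z X \<xi> p + dRic X \<xi> Z p)"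
      by (simp add: dRic_eta_parallel[OF assms(2)] vf algebra_simps)
    then show ?thesis by (simp add: sym vf)
  qed
qed

end
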